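(* Let $\mathbb{X}$ be a semi-abelian category and $M$ a proper chain complex in $\mathbb{X}$. Then for every $n$ the objects $H_n(M)$ and $K_n(M)$ are isomorphic and are given by $$H_n(M)\cong K_n(M)\cong ker_n(M)/cok_{n+1}(M),$$ where $H_n(M)$ and $K_n(M)$ are considered as chain complexes which are trivial except in degree $n$, where they have the objects $H_n(M)$ and $K_n(M)$ respectively.
   Context: A chain complex $M$ in $\mathbb{X}$ is a family of morphisms $\delta_i:M_i\to M_{i-1}$ ($i\in\mathbb{Z}$) with $\delta_i\delta_{i+1}=0$; it is proper if in each normal epi/mono factorization $\delta_i=m_ie_i$ (through the image $\delta_i(M_i)$) the monomorphism $m_i$ is normal. $H_n(M)$ is the cokernel of the morphism $M_{n+1}\to\mathrm{Ker}(\delta_n)$ induced by $\delta_{n+1}$, equivalently of the induced monomorphism $\delta_{n+1}(M_{n+1})\to\mathrm{Ker}(\delta_n)$. $K_n(M)$ is the kernel of the morphism $\mathrm{Cok}(\delta_{n+1})\to M_{n-1}$ induced by $\delta_n$, equivalently of the induced morphism $\mathrm{Cok}(\delta_{n+1})\to\delta_n(M_n)$. The torsion subobjects (normal subcomplexes) of $M$ are $cok_n(M)=(\dots\to M_{n+1}\to M_n\to\delta_n(M_n)\to0\to\dots)$, with $\delta_n(M_n)$ in degree $n-1$, which is the torsion part of $M$ for the torsion theory $\mathcal{COK}_n=(\mathcal{EP}_n,pch(\mathbb{X})_{n-1\geq})$; and $ker_n(M)=(\dots\to M_{n+1}\to\mathrm{Ker}(\delta_n)\to0\to\dots)$, with $\mathrm{Ker}(\delta_n)$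 in degree $n$, which is the torsion part of $M$ for the torsion theory $\mathcal{KER}_n=(pch(\mathbb{X})_{\geq n},\mathcal{MN}_n)$. Here $pch(\mathbb{X})$ is the category of proper chain complexes, $pch(\mathbb{X})_{k\geq}$ and $pch(\mathbb{X})_{\geq k}$ denote those with $M_i=0$ for $i>k$, resp. $i<k$; $\mathcal{EP}_n$ those with $\delta_n$ a normal epimorphism and $M_i=0$ for $i<n-1$; $\mathcal{MN}_n$ those with $\delta_n$ a normal monomorphism and $M_i=0$ for $i>n$. The quotient is taken in the category of chain complexes; $cok_{n+1}(M)\le ker_n(M)$. *)

theory Defs
  imports Main
begin

section \<open>Categories\<close>

record ('o, 'm) cat =
  Obj :: "'o set"
  Arr :: "'m set"
  Dom :: "'m \<Rightarrow> 'o"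
  Cod :: "'m \<Rightarrow> 'o"
  Ident :: "'o \<Rightarrow> 'm"
  Comp :: "'m \<Rightarrow> 'm \<Rightarrow> 'm" (infixl "\<cdot>\<index>" 70)

definition Hom :: "('o, 'm) cat \<Rightarrow> 'o \<Rightarrow> 'o \<Rightarrow> 'm set" where
  "Hom C A B = {f \<in> Arr C. Dom C f = A \<and> Cod C f = B}"

locale category =
  fixes C :: "('o, 'm) cat" (structure)
  assumes Dom_in_Obj: "f \<in> Arr C \<Longrightarrow> Dom C f \<in> Obj C"
    and Cod_in_Obj: "f \<in> Arr C \<Longrightarrow> Cod C f \<in> Obj C"
    and Ident_in_Hom: "A \<in> Obj C \<Longrightarrow> Ident C A \<in> Hom C A A"
    and Comp_in_Hom: "f \<in> Hom C A B \<Longrightarrow> g \<in> Hom C B D \<Longrightarrow> g \<cdot> f \<in> Hom C A D"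
    and Comp_Ident: "f \<in> Hom C A B \<Longrightarrow> f \<cdot> Ident C A = f"
    and Ident_Comp: "f \<in> Hom C A B \<Longrightarrow> Ident C B \<cdot> f = f"
    and Comp_assoc: "f \<in> Hom C A B \<Longrightarrow> g \<in> Hom C B D \<Longrightarrow> h \<in> Hom C D E \<Longrightarrow>
          (h \<cdot> g) \<cdot> f = h \<cdot> (g \<cdot> f)"

definition is_iso :: "('o, 'm) cat \<Rightarrow> 'm \<Rightarrow> bool" where
  "is_iso C f \<longleftrightarrow> f \<in> Arr C \<and>
     (\<exists>g \<in> Hom C (Cod C f) (Dom C f).
        g \<cdot>\<^bsub>C\<^esub> f = Ident C (Dom C f) \<and> f \<cdot>\<^bsub>C\<^esub> g = Ident C (Cod C f))"

definition isomorphic :: "('o, 'm) cat \<Rightarrow> 'o \<Rightarrow> 'o \<Rightarrow> bool" where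
  "isomorphic C A B \<longleftrightarrow> A \<in> Obj C \<and> B \<in> Obj C \<and> (\<exists>f \<in> Hom C A B. is_iso C f)"

definition is_mono :: "('o, 'm) cat \<Rightarrow> 'm \<Rightarrow> bool" where
  "is_mono C m \<longleftrightarrow> m \<in> Arr C \<and>
     (\<forall>T. \<forall>f \<in> Hom C T (Dom C m). \<forall>g \<in> Hom C T (Dom C m).
        m \<cdot>\<^bsub>C\<^esub> f = m \<cdot>\<^bsub>C\<^esub> g \<longrightarrow> f = g)"

definition is_terminal :: "('o, 'm) cat \<Rightarrow> 'o \<Rightarrow> bool" where
  "is_terminal C Z \<longleftrightarrow> Z \<in> Obj C \<and> (\<forall>A \<in> Obj C. \<exists>!f. f \<in> Hom C A Z)"

definition is_initial :: "('o, 'm) cat \<Rightarrow> 'o \<Rightarrow> bool" where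
  "is_initial C Z \<longleftrightarrow> Z \<in> Obj C \<and> (\<forall>A \<in> Obj C. \<exists>!f. f \<in> Hom C Z A)"

definition is_zero_obj :: "('o, 'm) cat \<Rightarrow> 'o \<Rightarrow> bool" where
  "is_zero_obj C Z \<longleftrightarrow> is_initial C Z \<and> is_terminal C Z"

definition is_pullback :: "('o, 'm) cat \<Rightarrow> 'm \<Rightarrow> 'm \<Rightarrow> 'm \<Rightarrow> 'm \<Rightarrow> bool" where
  "is_pullback C f g p q \<longleftrightarrow>
     f \<in> Arr C \<and> g \<in> Arr C \<and> Cod C f = Cod C g \<and>
     p \<in> Hom C (Dom C p) (Dom C f) \<and> q \<in> Hom C (Dom C p) (Dom C g) \<and>
     f \<cdot>\<^bsub>C\<^esub> p = g \<cdot>\<^bsub>C\<^esub> q \<and>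
     (\<forall>T. \<forall>x \<in> Hom C T (Dom C f). \<forall>y \<in> Hom C T (Dom C g).
        f \<cdot>\<^bsub>C\<^esub> x = g \<cdot>\<^bsub>C\<^esub> y \<longrightarrow>
        (\<exists>!u. u \<in> Hom C T (Dom C p) \<and> p \<cdot>\<^bsub>C\<^esub> u = x \<and> q \<cdot>\<^bsub>C\<^esub> u = y))"

definition is_coproduct :: "('o, 'm) cat \<Rightarrow> 'o \<Rightarrow> 'o \<Rightarrow> 'm \<Rightarrow> 'm \<Rightarrow> bool" where
  "is_coproduct C A B i j \<longleftrightarrow>
     i \<in> Hom C A (Cod C i) \<and> j \<in> Hom C B (Cod C i) \<and>
     (\<forall>T. \<forall>x \<in> Hom C A T. \<forall>y \<in> Hom C B T.
        \<exists>!u. u \<in> Hom C (Cod C i) T \<and> u \<cdot>\<^bsub>C\<^esub> i = x \<and> u \<cdot>\<^bsub>C\<^esub> j = y)"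

definition is_coequalizer :: "('o, 'm) cat \<Rightarrow> 'm \<Rightarrow> 'm \<Rightarrow> 'm \<Rightarrow> bool" where
  "is_coequalizer C f g e \<longleftrightarrow>
     f \<in> Arr C \<and> g \<in> Hom C (Dom C f) (Cod C f) \<and> e \<in> Hom C (Cod C f) (Cod C e) \<and>
     e \<cdot>\<^bsub>C\<^esub> f = e \<cdot>\<^bsub>C\<^esub> g \<and>
     (\<forall>T. \<forall>x \<in> Hom C (Cod C f) T. x \<cdot>\<^bsub>C\<^esub> f = x \<cdot>\<^bsub>C\<^esub> g \<longrightarrow>
        (\<exists>!u. u \<in> Hom C (Cod C e) T \<and> u \<cdot>\<^bsub>C\<^esub> e = x))"

definition is_regular_epi :: "('o, 'm) cat \<Rightarrow> 'm \<Rightarrow> bool" where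
  "is_regular_epi C e \<longleftrightarrow> (\<exists>f g. is_coequalizer C f g e)"


section \<open>Semi-abelian categories\<close>

locale finitely_complete_category = category +
  assumes has_terminal: "\<exists>Z. is_terminal C Z"
    and has_pullbacks: "f \<in> Hom C A D \<Longrightarrow> g \<in> Hom C B D \<Longrightarrow> \<exists>p q. is_pullback C f g p q"

locale regular_category = finitely_complete_category +
  assumes kernel_pairs_have_coequalizers:
      "is_pullback C f f r s \<Longrightarrow> \<exists>e. is_coequalizer C r s e"
    and regular_epis_stable:
      "is_regular_epi C f \<Longrightarrow> is_pullback C f g p q \<Longrightarrow> is_regular_epi C q"

definition is_equivalence_relation :: "('o, 'm) cat \<Rightarrow> 'o \<Rightarrow> 'm \<Rightarrow> 'm \<Rightarrow> bool" where
  "is_equivalence_relation C X r s \<longleftrightarrow>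
     r \<in> Hom C (Dom C r) X \<and> s \<in> Hom C (Dom C r) X \<and>
     (\<forall>T. \<forall>u \<in> Hom C T (Dom C r). \<forall>v \<in> Hom C T (Dom C r).
        r \<cdot>\<^bsub>C\<^esub> u = r \<cdot>\<^bsub>C\<^esub> v \<and> s \<cdot>\<^bsub>C\<^esub> u = s \<cdot>\<^bsub>C\<^esub> v \<longrightarrow> u = v) \<and>
     (\<exists>d \<in> Hom C X (Dom C r). r \<cdot>\<^bsub>C\<^esub> d = Ident C X \<and> s \<cdot>\<^bsub>C\<^esub> d = Ident C X) \<and>
     (\<exists>w \<in> Hom C (Dom C r) (Dom C r). r \<cdot>\<^bsub>C\<^esub> w = s \<and> s \<cdot>\<^bsub>C\<^esub> w = r) \<and>
     (\<forall>p q. is_pullback C s r p q \<longrightarrow>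
        (\<exists>t \<in> Hom C (Dom C p) (Dom C r).
           r \<cdot>\<^bsub>C\<^esub> t = r \<cdot>\<^bsub>C\<^esub> p \<and> s \<cdot>\<^bsub>C\<^esub> t = s \<cdot>\<^bsub>C\<^esub> q))"

locale barr_exact_category = regular_category +
  assumes equivalence_relations_effective:
    "is_equivalence_relation C X r s \<Longrightarrow> \<exists>f. is_pullback C f f r s"

text \<open>
  Bourn protomodularity: every change-of-base functor of the fibration of points reflects
  isomorphisms. Below, \<open>h\<close> is a morphism from the point \<open>(p, s)\<close> to the point \<open>(q, t)\<close> over \<open>B\<close>,
  and \<open>u\<close> is its image under change of base along \<open>f\<close>.
\<close>

definition is_protomodular :: "('o, 'm) cat \<Rightarrow> bool" where
  "is_protomodular C \<longleftrightarrow>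
     (\<forall>A A' B p s q t h f p1 p2 q1 q2 u.
        p \<in> Hom C A B \<and> s \<in> Hom C B A \<and> p \<cdot>\<^bsub>C\<^esub> s = Ident C B \<and>
        q \<in> Hom C A' B \<and> t \<in> Hom C B A' \<and> q \<cdot>\<^bsub>C\<^esub> t = Ident C B \<and>
        h \<in> Hom C A A' \<and> q \<cdot>\<^bsub>C\<^esub> h = p \<and> h \<cdot>\<^bsub>C\<^esub> s = t \<and>
        is_pullback C p f p1 p2 \<and> is_pullback C q f q1 q2 \<and>
        u \<in> Hom C (Dom C p1) (Dom C q1) \<and> q1 \<cdot>\<^bsub>C\<^esub> u = h \<cdot>\<^bsub>C\<^esub> p1 \<and> q2 \<cdot>\<^bsub>C\<^esub> u = p2 \<and>
        is_iso C u
        \<longrightarrow> is_iso C h)"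

locale semi_abelian_category = barr_exact_category +
  assumes has_zero_obj: "\<exists>Z. is_zero_obj C Z"
    and has_binary_coproducts:
      "A \<in> Obj C \<Longrightarrow> B \<in> Obj C \<Longrightarrow> \<exists>i j. is_coproduct C A B i j"
    and protomodular: "is_protomodular C"


section \<open>Zero morphisms, kernels, cokernels and images\<close>

text \<open>
  The functions \<open>zero_obj\<close>, \<open>ker\<close>, \<open>cok\<close> and \<open>img\<close> choose one representative of a notion that is
  determined up to isomorphism; they are meaningful only where such a representative exists.
\<close>

definition zero_obj :: "('o, 'm) cat \<Rightarrow> 'o" where
  "zero_obj C = (SOME Z. is_zero_obj C Z)"

definition is_zero_arr :: "('o, 'm) cat \<Rightarrow> 'm \<Rightarrow> bool" where
  "is_zero_arr C f \<longleftrightarrow> f \<in> Arr C \<and>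
     (\<exists>Z. is_zero_obj C Z \<and>
        (\<exists>a \<in> Hom C (Dom C f) Z. \<exists>b \<in> Hom C Z (Cod C f). f = b \<cdot>\<^bsub>C\<^esub> a))"

definition zero_arr :: "('o, 'm) cat \<Rightarrow> 'o \<Rightarrow> 'o \<Rightarrow> 'm" where
  "zero_arr C A B = (THE f. f \<in> Hom C A B \<and> is_zero_arr C f)"

definition is_kernel :: "('o, 'm) cat \<Rightarrow> 'm \<Rightarrow> 'm \<Rightarrow> bool" where
  "is_kernel C f k \<longleftrightarrow>
     f \<in> Arr C \<and> k \<in> Hom C (Dom C k) (Dom C f) \<and> is_zero_arr C (f \<cdot>\<^bsub>C\<^esub> k) \<and>
     (\<forall>T. \<forall>x \<in> Hom C T (Dom C f). is_zero_arr C (f \<cdot>\<^bsub>C\<^esub> x) \<longrightarrow>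
        (\<exists>!u. u \<in> Hom C T (Dom C k) \<and> k \<cdot>\<^bsub>C\<^esub> u = x))"

definition is_cokernel :: "('o, 'm) cat \<Rightarrow> 'm \<Rightarrow> 'm \<Rightarrow> bool" where
  "is_cokernel C f c \<longleftrightarrow>
     f \<in> Arr C \<and> c \<in> Hom C (Cod C f) (Cod C c) \<and> is_zero_arr C (c \<cdot>\<^bsub>C\<^esub> f) \<and>
     (\<forall>T. \<forall>x \<in> Hom C (Cod C f) T. is_zero_arr C (x \<cdot>\<^bsub>C\<^esub> f) \<longrightarrow>
        (\<exists>!u. u \<in> Hom C (Cod C c) T \<and> u \<cdot>\<^bsub>C\<^esub> c = x))"

definition ker :: "('o, 'm) cat \<Rightarrow> 'm \<Rightarrow> 'm" where
  "ker C f = (SOME k. is_kernel C f k)"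

definition Ker :: "('o, 'm) cat \<Rightarrow> 'm \<Rightarrow> 'o" where
  "Ker C f = Dom C (ker C f)"

definition cok :: "('o, 'm) cat \<Rightarrow> 'm \<Rightarrow> 'm" where
  "cok C f = (SOME c. is_cokernel C f c)"

definition Cok :: "('o, 'm) cat \<Rightarrow> 'm \<Rightarrow> 'o" where
  "Cok C f = Cod C (cok C f)"

definition is_normal_mono :: "('o, 'm) cat \<Rightarrow> 'm \<Rightarrow> bool" where
  "is_normal_mono C m \<longleftrightarrow> (\<exists>f. is_kernel C f m)"

definition is_normal_epi :: "('o, 'm) cat \<Rightarrow> 'm \<Rightarrow> bool" where
  "is_normal_epi C e \<longleftrightarrow> (\<exists>f. is_cokernel C f e)"

definition is_factorization :: "('o, 'm) cat \<Rightarrow> 'm \<Rightarrow> 'm \<Rightarrow> 'm \<Rightarrow> bool" where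
  "is_factorization C f e m \<longleftrightarrow>
     f \<in> Arr C \<and> e \<in> Hom C (Dom C f) (Dom C m) \<and> m \<in> Hom C (Dom C m) (Cod C f) \<and>
     is_normal_epi C e \<and> is_mono C m \<and> f = m \<cdot>\<^bsub>C\<^esub> e"

definition img :: "('o, 'm) cat \<Rightarrow> 'm \<Rightarrow> 'm \<times> 'm" where
  "img C f = (SOME (e, m). is_factorization C f e m)"

definition img_epi :: "('o, 'm) cat \<Rightarrow> 'm \<Rightarrow> 'm" where
  "img_epi C f = fst (img C f)"

definition img_mono :: "('o, 'm) cat \<Rightarrow> 'm \<Rightarrow> 'm" where
  "img_mono C f = snd (img C f)"

definition Img :: "('o, 'm) cat \<Rightarrow> 'm \<Rightarrow> 'o" where
  "Img C f = Dom C (img_mono C f)"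

text \<open>
  \<open>lift C k f\<close> is the morphism induced by \<open>f\<close> into the domain of the monomorphism \<open>k\<close>, and
  \<open>colift C c f\<close> the one induced by \<open>f\<close> out of the codomain of the epimorphism \<open>c\<close>.
\<close>

definition lift :: "('o, 'm) cat \<Rightarrow> 'm \<Rightarrow> 'm \<Rightarrow> 'm" where
  "lift C k f = (THE u. u \<in> Hom C (Dom C f) (Dom C k) \<and> k \<cdot>\<^bsub>C\<^esub> u = f)"

definition colift :: "('o, 'm) cat \<Rightarrow> 'm \<Rightarrow> 'm \<Rightarrow> 'm" where
  "colift C c f = (THE u. u \<in> Hom C (Cod C c) (Cod C f) \<and> u \<cdot>\<^bsub>C\<^esub> c = f)"


section \<open>Chain complexes\<close>

record ('o, 'm) chain =
  ob :: "int \<Rightarrow> 'o"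
  diff :: "int \<Rightarrow> 'm"

definition is_chain :: "('o, 'm) cat \<Rightarrow> ('o, 'm) chain \<Rightarrow> bool" where
  "is_chain C M \<longleftrightarrow>
     (\<forall>i. ob M i \<in> Obj C \<and> diff M i \<in> Hom C (ob M i) (ob M (i - 1)) \<and>
          is_zero_arr C (diff M i \<cdot>\<^bsub>C\<^esub> diff M (i + 1)))"

definition is_proper_chain :: "('o, 'm) cat \<Rightarrow> ('o, 'm) chain \<Rightarrow> bool" where
  "is_proper_chain C M \<longleftrightarrow> is_chain C M \<and>
     (\<forall>i e m. is_factorization C (diff M i) e m \<longrightarrow> is_normal_mono C m)"

text \<open>A chain map carries its source and target, so that domain and codomain are functions.\<close>

type_synonym ('o, 'm) chain_map = "('o, 'm) chain \<times> ('o, 'm) chain \<times> (int \<Rightarrow> 'm)"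

definition Ch :: "('o, 'm) cat \<Rightarrow> (('o, 'm) chain, ('o, 'm) chain_map) cat" where
  "Ch C =
     \<lparr>Obj = {M. is_chain C M},
      Arr = {(M, N, f). is_chain C M \<and> is_chain C N \<and>
               (\<forall>i. f i \<in> Hom C (ob M i) (ob N i) \<and>
                    diff N i \<cdot>\<^bsub>C\<^esub> f i = f (i - 1) \<cdot>\<^bsub>C\<^esub> diff M i)},
      Dom = (\<lambda>(M, N, f). M),
      Cod = (\<lambda>(M, N, f). N),
      Ident = (\<lambda>M. (M, M, \<lambda>i. Ident C (ob M i))),
      Comp = (\<lambda>(N, P, g) (M, N', f). (M, P, \<lambda>i. g i \<cdot>\<^bsub>C\<^esub> f i))\<rparr>"

lemma category_Ch:
  assumes "category C"
  shows "category (Ch C)"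
proof -
  interpret category C by fact
  have comm: "diff P i \<cdot>\<^bsub>C\<^esub> (g i \<cdot>\<^bsub>C\<^esub> f i) = (g (i - 1) \<cdot>\<^bsub>C\<^esub> f (i - 1)) \<cdot>\<^bsub>C\<^esub> diff M i"
    if "is_chain C M" "is_chain C N" "is_chain C P"
      and f: "\<forall>i. f i \<in> Hom C (ob M i) (ob N i) \<and> diff N i \<cdot>\<^bsub>C\<^esub> f i = f (i - 1) \<cdot>\<^bsub>C\<^esub> diff M i"
      and g: "\<forall>i. g i \<in> Hom C (ob N i) (ob P i) \<and> diff P i \<cdot>\<^bsub>C\<^esub> g i = g (i - 1) \<cdot>\<^bsub>C\<^esub> diff N i"
    for M N P f g and i :: int
  proof -
    have fg: "f i \<in> Hom C (ob M i) (ob N i)" "g i \<in> Hom C (ob N i) (ob P i)"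
      "f (i - 1) \<in> Hom C (ob M (i - 1)) (ob N (i - 1))"
      "g (i - 1) \<in> Hom C (ob N (i - 1)) (ob P (i - 1))"
      using f g by blast+
    have d: "diff M i \<in> Hom C (ob M i) (ob M (i - 1))" "diff N i \<in> Hom C (ob N i) (ob N (i - 1))"
      "diff P i \<in> Hom C (ob P i) (ob P (i - 1))"
      using that(1-3) by (auto simp: is_chain_def)
    have "diff P i \<cdot>\<^bsub>C\<^esub> (g i \<cdot>\<^bsub>C\<^esub> f i) = (diff P i \<cdot>\<^bsub>C\<^esub> g i) \<cdot>\<^bsub>C\<^esub> f i"
      using Comp_assoc[OF fg(1,2) d(3)] by simp
    also have "\<dots> = g (i - 1) \<cdot>\<^bsub>C\<^esub> (diff N i \<cdot>\<^bsub>C\<^esub> f i)"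
      using Comp_assoc[OF fg(1) d(2) fg(4)] g by simp
    also have "\<dots> = (g (i - 1) \<cdot>\<^bsub>C\<^esub> f (i - 1)) \<cdot>\<^bsub>C\<^esub> diff M i"
      using Comp_assoc[OF d(1) fg(3,4)] f by simp
    finally show ?thesis .
  qed
  have d: "diff M i \<in> Hom C (ob M i) (ob M (i - 1))" if "is_chain C M" for M i
    using that by (auto simp: is_chain_def)
  have hom: "x \<in> Hom (Ch C) A B \<longleftrightarrow>
      (\<exists>f. x = (A, B, f) \<and> is_chain C A \<and> is_chain C B \<and>
        (\<forall>i. f i \<in> Hom C (ob A i) (ob B i) \<and> diff B i \<cdot>\<^bsub>C\<^esub> f i = f (i - 1) \<cdot>\<^bsub>C\<^esub> diff A i))" for x A B
    unfolding Hom_def[of "Ch C" A B] by (cases x) (auto simp: Ch_def)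
  show ?thesis
  proof
    fix x A B y D assume "x \<in> Hom (Ch C) A B" "y \<in> Hom (Ch C) B D"
    then obtain f g where fg: "x = (A, B, f)" "y = (B, D, g)"
      and c: "is_chain C A" "is_chain C B" "is_chain C D"
      and f: "\<forall>i. f i \<in> Hom C (ob A i) (ob B i) \<and> diff B i \<cdot>\<^bsub>C\<^esub> f i = f (i - 1) \<cdot>\<^bsub>C\<^esub> diff A i"
      and g: "\<forall>i. g i \<in> Hom C (ob B i) (ob D i) \<and> diff D i \<cdot>\<^bsub>C\<^esub> g i = g (i - 1) \<cdot>\<^bsub>C\<^esub> diff B i"
      by (auto simp: hom)
    have "y \<cdot>\<^bsub>Ch C\<^esub> x = (A, D, \<lambda>i. g i \<cdot>\<^bsub>C\<^esub> f i)"
      by (simp add: fg Ch_def)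
    moreover have "g i \<cdot>\<^bsub>C\<^esub> f i \<in> Hom C (ob A i) (ob D i)" for i
      using Comp_in_Hom f g by blast
    ultimately show "y \<cdot>\<^bsub>Ch C\<^esub> x \<in> Hom (Ch C) A D"
      using c comm[OF c f g] by (simp add: hom)
  next
    fix A assume "A \<in> Obj (Ch C)"
    then have A: "is_chain C A" by (simp add: Ch_def)
    then have "ob A i \<in> Obj C" for i
      by (simp add: is_chain_def)
    moreover have "diff A i \<cdot>\<^bsub>C\<^esub> Ident C (ob A i) = Ident C (ob A (i - 1)) \<cdot>\<^bsub>C\<^esub> diff A i" for i
      using Comp_Ident[OF d[OF A]] Ident_Comp[OF d[OF A]] by simp
    moreover have "Ident (Ch C) A = (A, A, \<lambda>i. Ident C (ob A i))"
      by (simp add: Ch_def)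
    ultimately show "Ident (Ch C) A \<in> Hom (Ch C) A A"
      using A Ident_in_Hom by (simp add: hom)
  next
    fix x A B y D z E
    assume "x \<in> Hom (Ch C) A B" "y \<in> Hom (Ch C) B D" "z \<in> Hom (Ch C) D E"
    then obtain f g h where e: "x = (A, B, f)" "y = (B, D, g)" "z = (D, E, h)"
      and *: "\<And>i. f i \<in> Hom C (ob A i) (ob B i)" "\<And>i. g i \<in> Hom C (ob B i) (ob D i)"
        "\<And>i. h i \<in> Hom C (ob D i) (ob E i)"
      by (auto simp: hom)
    show "(z \<cdot>\<^bsub>Ch C\<^esub> y) \<cdot>\<^bsub>Ch C\<^esub> x = z \<cdot>\<^bsub>Ch C\<^esub> (y \<cdot>\<^bsub>Ch C\<^esub> x)"
      using Comp_assoc[OF *] by (simp add: e Ch_def)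
  next
    fix x A B assume "x \<in> Hom (Ch C) A B"
    then obtain f where e: "x = (A, B, f)" and *: "\<And>i. f i \<in> Hom C (ob A i) (ob B i)"
      by (auto simp: hom)
    show "x \<cdot>\<^bsub>Ch C\<^esub> Ident (Ch C) A = x" "Ident (Ch C) B \<cdot>\<^bsub>Ch C\<^esub> x = x"
      using Comp_Ident[OF *] Ident_Comp[OF *] by (simp_all add: e Ch_def)
  qed (auto simp: Ch_def)
qed

definition homology :: "('o, 'm) cat \<Rightarrow> ('o, 'm) chain \<Rightarrow> int \<Rightarrow> 'o" where
  "homology C M n = Cok C (lift C (ker C (diff M n)) (diff M (n + 1)))"

definition dual_homology :: "('o, 'm) cat \<Rightarrow> ('o, 'm) chain \<Rightarrow> int \<Rightarrow> 'o" where
  "dual_homology C M n = Ker C (colift C (cok C (diff M (n + 1))) (diff M n))"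

definition concentrated :: "('o, 'm) cat \<Rightarrow> int \<Rightarrow> 'o \<Rightarrow> ('o, 'm) chain" where
  "concentrated C n A =
     (let X = (\<lambda>i. if i = n then A else zero_obj C)
      in \<lparr>ob = X, diff = (\<lambda>i. zero_arr C (X i) (X (i - 1)))\<rparr>)"

definition ker_part :: "('o, 'm) cat \<Rightarrow> int \<Rightarrow> ('o, 'm) chain \<Rightarrow> ('o, 'm) chain" where
  "ker_part C n M =
     (let X = (\<lambda>i. if i > n then ob M i
                   else if i = n then Ker C (diff M n)
                   else zero_obj C)
      in \<lparr>ob = X,
          diff = (\<lambda>i. if i > n + 1 then diff M i
                      else if i = n + 1 then lift C (ker C (diff M n)) (diff M (n + 1))
                      else zero_arr C (X i) (X (i - 1)))\<rparr>)"

definition ker_incl :: "('o, 'm) cat \<Rightarrow> int \<Rightarrow> ('o, 'm) chain \<Rightarrow> ('o, 'm) chain_map" where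
  "ker_incl C n M =
     (ker_part C n M, M,
      \<lambda>i. if i > n then Ident C (ob M i)
          else if i = n then ker C (diff M n)
          else zero_arr C (zero_obj C) (ob M i))"

definition cok_part :: "('o, 'm) cat \<Rightarrow> int \<Rightarrow> ('o, 'm) chain \<Rightarrow> ('o, 'm) chain" where
  "cok_part C n M =
     (let X = (\<lambda>i. if i \<ge> n then ob M i
                   else if i = n - 1 then Img C (diff M n)
                   else zero_obj C)
      in \<lparr>ob = X,
          diff = (\<lambda>i. if i > n then diff M i
                      else if i = n then img_epi C (diff M n)
                      else zero_arr C (X i) (X (i - 1)))\<rparr>)"

definition cok_incl :: "('o, 'm) cat \<Rightarrow> int \<Rightarrow> ('o, 'm) chain \<Rightarrow> ('o, 'm) chain_map" where
  "cok_incl C n M =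
     (cok_part C n M, M,
      \<lambda>i. if i \<ge> n then Ident C (ob M i)
          else if i = n - 1 then img_mono C (diff M n)
          else zero_arr C (zero_obj C) (ob M i))"

text \<open>
  For subobjects \<open>a \<le> b\<close> of the same object, \<open>subobj_quotient C b a\<close> is the cokernel of the
  inclusion of (the domain of) \<open>a\<close> into (the domain of) \<open>b\<close>.
\<close>

definition subobj_quotient :: "('o, 'm) cat \<Rightarrow> 'm \<Rightarrow> 'm \<Rightarrow> 'o" where
  "subobj_quotient C b a = Cok C (lift C b a)"

end

theory Submission
  imports Defs
begin

text \<open>Let \<open>q\<close> be the cokernel of \<open>\<delta>\<^bsub>n+1\<^esub>\<close>. As \<open>M\<close> is proper, the kernel of \<open>q\<close> is the image of
  \<open>\<delta>\<^bsub>n+1\<^esub>\<close>. The morphism \<open>q\<close> restricts to a morphism from \<open>Ker \<delta>\<^sub>n = q\<^sup>-\<^sup>1(K\<^sub>n(M))\<close> to \<open>K\<^sub>n(M)\<close>, which is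
  a pullback of \<open>q\<close> and hence a regular epimorphism with the same kernel. By protomodularity regular
  epimorphisms are cokernels of their kernels, so \<open>K\<^sub>n(M)\<close> is a cokernel of the inclusion of the image
  in \<open>Ker \<delta>\<^sub>n\<close>, that is, \<open>H\<^sub>n(M)\<close>. That inclusion is the degree \<open>n\<close> part of
  \<open>cok\<^bsub>n+1\<^esub>(M) \<le> ker\<^sub>n(M)\<close>, which is an isomorphism in all other degrees.\<close>

section \<open>Pointed categories\<close>

text \<open>The only coequalizers assumed are those of kernel pairs, while \<open>ker\<close>,
  \<open>cok\<close>, \<open>img\<close>, \<open>lift\<close> and \<open>colift\<close> are choices
  or descriptions that mean something only once existence is known. So every cokernel in the
  statement has to be exhibited before it can be used. Properness of \<open>diff M (n + 1)\<close>
  therefore enters twice: it gives the image \<open>m\<close> a cokernel at all, and it makes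
  \<open>m\<close> the kernel of that cokernel. Likewise chain complexes are treated merely as a
  pointed category, in which the one cokernel that matters is built by hand from a cokernel in
  degree \<open>n\<close>.\<close>

context category
begin

lemma Hom_Obj:
  assumes "f \<in> Hom C A B"
  shows "A \<in> Obj C" "B \<in> Obj C"
  using assms Dom_in_Obj Cod_in_Obj by (auto simp: Hom_def)

lemma Hom_Arr:
  assumes "f \<in> Hom C A B"
  shows "f \<in> Arr C" "Dom C f = A" "Cod C f = B"
  using assms by (auto simp: Hom_def)

lemma Arr_Hom: "f \<in> Arr C \<Longrightarrow> f \<in> Hom C (Dom C f) (Cod C f)"
  by (simp add: Hom_def)

lemma is_isoI:
  assumes "f \<in> Hom C A B" "g \<in> Hom C B A" "g \<cdot> f = Ident C A" "f \<cdot> g = Ident C B"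
  shows "is_iso C f"
  using assms unfolding is_iso_def by (auto simp: Hom_Arr[OF assms(1)])

lemma is_isoE:
  assumes "is_iso C f" "f \<in> Hom C A B"
  obtains g where "g \<in> Hom C B A" "g \<cdot> f = Ident C A" "f \<cdot> g = Ident C B"
  using assms unfolding is_iso_def by (auto simp: Hom_Arr[OF assms(2)])

lemma isomorphicI:
  assumes "f \<in> Hom C A B" "g \<in> Hom C B A" "g \<cdot> f = Ident C A" "f \<cdot> g = Ident C B"
  shows "isomorphic C A B"
  using assms is_isoI[OF assms] Hom_Obj[OF assms(1)] unfolding isomorphic_def by blast

lemma isomorphicE:
  assumes "isomorphic C A B"
  obtains f g where "f \<in> Hom C A B" "g \<in> Hom C B A" "g \<cdot> f = Ident C A" "f \<cdot> g = Ident C B"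
  using assms unfolding isomorphic_def by (metis is_isoE)

lemma isomorphic_sym: "isomorphic C A B \<Longrightarrow> isomorphic C B A"
  by (metis isomorphicE isomorphicI)

section \<open>Pullbacks, coequalizers and monomorphisms in an arbitrary category\<close>

lemma is_pullback_iff:
  assumes "f \<in> Hom C A D" "g \<in> Hom C B D" "p \<in> Hom C P A" "q \<in> Hom C P B"
  shows "is_pullback C f g p q \<longleftrightarrow> f \<cdot> p = g \<cdot> q \<and>
    (\<forall>T. \<forall>x \<in> Hom C T A. \<forall>y \<in> Hom C T B. f \<cdot> x = g \<cdot> y \<longrightarrow>
       (\<exists>!u. u \<in> Hom C T P \<and> p \<cdot> u = x \<and> q \<cdot> u = y))"
  using assms unfolding is_pullback_def by (simp add: Hom_Arr[OF assms(1)] Hom_Arr[OF assms(2)]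
      Hom_Arr[OF assms(3)] Hom_Arr[OF assms(4)])

lemma is_pullback_Hom:
  assumes "is_pullback C f g p q" "f \<in> Hom C A D" "g \<in> Hom C B D"
  shows "p \<in> Hom C (Dom C p) A" "q \<in> Hom C (Dom C p) B"
  using assms(1) unfolding is_pullback_def
  by (auto simp: Hom_Arr[OF assms(2)] Hom_Arr[OF assms(3)])

lemma is_pullback_commute: "is_pullback C f g p q \<Longrightarrow> f \<cdot> p = g \<cdot> q"
  by (simp add: is_pullback_def)

lemma is_pullback_factor:
  assumes "is_pullback C f g p q" "f \<in> Hom C A D" "g \<in> Hom C B D"
    and "x \<in> Hom C T A" "y \<in> Hom C T B" "f \<cdot> x = g \<cdot> y"
  obtains u where "u \<in> Hom C T (Dom C p)" "p \<cdot> u = x" "q \<cdot> u = y"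
  using assms(1)[unfolded is_pullback_iff[OF assms(2,3) is_pullback_Hom[OF assms(1-3)]]] assms(4-6)
  by blast

lemma is_pullback_cancel:
  assumes "is_pullback C f g p q" "f \<in> Hom C A D" "g \<in> Hom C B D"
    and "u \<in> Hom C T (Dom C p)" "v \<in> Hom C T (Dom C p)" "p \<cdot> u = p \<cdot> v" "q \<cdot> u = q \<cdot> v"
  shows "u = v"
proof -
  note pq = is_pullback_Hom[OF assms(1-3)]
  have "p \<cdot> u \<in> Hom C T A" "q \<cdot> u \<in> Hom C T B"
    using assms(4) pq by (blast intro: Comp_in_Hom)+
  moreover have "f \<cdot> (p \<cdot> u) = g \<cdot> (q \<cdot> u)"
    using is_pullback_commute[OF assms(1)] Comp_assoc[OF assms(4) pq(1) assms(2)]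
      Comp_assoc[OF assms(4) pq(2) assms(3)] by simp
  ultimately have "\<exists>!w. w \<in> Hom C T (Dom C p) \<and> p \<cdot> w = p \<cdot> u \<and> q \<cdot> w = q \<cdot> u"
    using assms(1)[unfolded is_pullback_iff[OF assms(2,3) pq]] by blast
  then show ?thesis using assms(4-7) by metis
qed

lemma is_coequalizer_Hom:
  assumes "is_coequalizer C f g e" "e \<in> Hom C B D"
  shows "f \<in> Hom C (Dom C f) B" "g \<in> Hom C (Dom C f) B"
  using assms unfolding is_coequalizer_def by (auto simp: Hom_def)

lemma is_coequalizer_commute: "is_coequalizer C f g e \<Longrightarrow> e \<cdot> f = e \<cdot> g"
  by (simp add: is_coequalizer_def)

lemma is_coequalizer_factor:
  assumes "is_coequalizer C f g e" "e \<in> Hom C B D" "x \<in> Hom C B T" "x \<cdot> f = x \<cdot> g"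
  shows "\<exists>!u. u \<in> Hom C D T \<and> u \<cdot> e = x"
  using assms(1,3,4) is_coequalizer_Hom[OF assms(1,2)] unfolding is_coequalizer_def
  by (simp add: Hom_Arr(3)[OF assms(2)] Hom_Arr(3)[OF is_coequalizer_Hom(1)[OF assms(1,2)]])

text \<open>The composite \<open>x \<cdot> e\<close> equalizes the pair that \<open>e\<close>
  coequalizes, so it factors through \<open>e\<close> in only one way, and both \<open>x\<close> and
  \<open>y\<close> are such factorizations.\<close>

lemma regular_epi_cancel:
  assumes "is_regular_epi C e" "e \<in> Hom C B D" "x \<in> Hom C D T" "y \<in> Hom C D T"
    and "x \<cdot> e = y \<cdot> e"
  shows "x = y"
proof -
  obtain f g where c: "is_coequalizer C f g e"
    using assms(1) unfolding is_regular_epi_def by blast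
  note fg = is_coequalizer_Hom[OF c assms(2)]
  have "(x \<cdot> e) \<cdot> f = (x \<cdot> e) \<cdot> g"
    using is_coequalizer_commute[OF c] Comp_assoc[OF fg(1) assms(2,3)]
      Comp_assoc[OF fg(2) assms(2,3)] by simp
  from is_coequalizer_factor[OF c assms(2) Comp_in_Hom[OF assms(2,3)] this]
  show ?thesis using assms(3-5) by metis
qed

lemma is_monoI:
  assumes "m \<in> Hom C A B"
    and "\<And>T f g. f \<in> Hom C T A \<Longrightarrow> g \<in> Hom C T A \<Longrightarrow> m \<cdot> f = m \<cdot> g \<Longrightarrow> f = g"
  shows "is_mono C m"
  using assms unfolding is_mono_def by (auto simp: Hom_Arr[OF assms(1)])

lemma is_monoD:
  assumes "is_mono C m" "m \<in> Hom C A B" "f \<in> Hom C T A" "g \<in> Hom C T A" "m \<cdot> f = m \<cdot> g"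
  shows "f = g"
  using assms unfolding is_mono_def by (auto simp: Hom_Arr[OF assms(2)])

lemma mono_factor:
  assumes "is_mono C (k \<cdot> j)" "j \<in> Hom C A B" "k \<in> Hom C B D"
  shows "is_mono C j"
proof (rule is_monoI[OF assms(2)])
  fix T x y assume xy: "x \<in> Hom C T A" "y \<in> Hom C T A" "j \<cdot> x = j \<cdot> y"
  then have "(k \<cdot> j) \<cdot> x = (k \<cdot> j) \<cdot> y"
    using Comp_assoc[OF xy(1) assms(2,3)] Comp_assoc[OF xy(2) assms(2,3)] by simp
  then show "x = y"
    using is_monoD[OF assms(1) Comp_in_Hom[OF assms(2,3)] xy(1,2)] by simp
qed

text \<open>\<open>lift\<close> is a definite description: some factorization must be exhibited, and
  monicity of \<open>k\<close> makes it the only one. Facts about \<open>lift\<close> are derived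
  through this rule, in the base category and in \<open>Ch C\<close> alike.\<close>

lemma lift_eqI:
  assumes "is_mono C k" "k \<in> Hom C K B" "u \<in> Hom C A K" "k \<cdot> u = f"
  shows "lift C k f = u"
proof -
  have "Dom C f = A"
    using Comp_in_Hom[OF assms(3,2)] assms(4) by (simp add: Hom_Arr)
  then show ?thesis
    unfolding lift_def Hom_Arr[OF assms(2)]
    using assms by (auto intro!: the_equality dest: is_monoD)
qed

end

text \<open>Kept apart from the semi-abelian locale because it is instantiated a second time with
  \<open>Ch C\<close>, of which only pointedness is established.\<close>

locale pointed_category = category +
  assumes zero_obj_exists: "\<exists>Z. is_zero_obj C Z"
begin

lemma is_zero_obj_zero_obj: "is_zero_obj C (zero_obj C)"
  unfolding zero_obj_def using zero_obj_exists by (rule someI_ex)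

lemma zero_obj_in_Obj [simp]: "zero_obj C \<in> Obj C"
  using is_zero_obj_zero_obj by (simp add: is_zero_obj_def is_initial_def)

text \<open>The two arrows may pass through different zero objects \<open>Z\<close> and
  \<open>Z'\<close>. A comparison \<open>z\<close> from \<open>Z\<close> to \<open>Z'\<close> turns
  one factorization into the other, since arrows into or out of a zero object are unique.\<close>

lemma is_zero_arr_unique:
  assumes "is_zero_arr C f" "is_zero_arr C g" "f \<in> Hom C A B" "g \<in> Hom C A B"
  shows "f = g"
proof -
  obtain Z a b where f: "is_zero_obj C Z" "a \<in> Hom C A Z" "b \<in> Hom C Z B" "f = b \<cdot> a"
    using assms(1) unfolding is_zero_arr_def by (auto simp: Hom_Arr[OF assms(3)])
  obtain Z' a' b' where g: "is_zero_obj C Z'" "a' \<in> Hom C A Z'" "b' \<in> Hom C Z' B" "g = b' \<cdot> a'"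
    using assms(2) unfolding is_zero_arr_def by (auto simp: Hom_Arr[OF assms(4)])
  obtain z where z: "z \<in> Hom C Z Z'"
    using f(1) g(1) unfolding is_zero_obj_def is_initial_def by blast
  have "z \<cdot> a = a'"
    using g(1) f(2) z g(2) Comp_in_Hom Hom_Obj(1)[OF f(2)]
    unfolding is_zero_obj_def is_terminal_def by blast
  moreover have "b' \<cdot> z = b"
    using f(1) f(3) z g(3) Comp_in_Hom Hom_Obj(2)[OF f(3)]
    unfolding is_zero_obj_def is_initial_def by blast
  ultimately show ?thesis
    using f g z by (metis Comp_assoc)
qed

lemma ex_is_zero_arr:
  assumes "A \<in> Obj C" "B \<in> Obj C"
  shows "\<exists>f \<in> Hom C A B. is_zero_arr C f"
proof -
  obtain a b where ab: "a \<in> Hom C A (zero_obj C)" "b \<in> Hom C (zero_obj C) B"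
    using is_zero_obj_zero_obj assms
    unfolding is_zero_obj_def is_initial_def is_terminal_def by blast
  then have h: "b \<cdot> a \<in> Hom C A B" by (rule Comp_in_Hom)
  then have "is_zero_arr C (b \<cdot> a)"
    using ab is_zero_obj_zero_obj unfolding is_zero_arr_def by (auto simp: Hom_Arr[OF h])
  with h show ?thesis by blast
qed

lemma zero_arr:
  assumes "A \<in> Obj C" "B \<in> Obj C"
  shows zero_arr_in_Hom: "zero_arr C A B \<in> Hom C A B"
    and is_zero_arr_zero_arr: "is_zero_arr C (zero_arr C A B)"
proof -
  have "\<exists>!f. f \<in> Hom C A B \<and> is_zero_arr C f"
    using ex_is_zero_arr[OF assms] is_zero_arr_unique by blast
  from theI'[OF this] show "zero_arr C A B \<in> Hom C A B" "is_zero_arr C (zero_arr C A B)"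
    unfolding zero_arr_def by auto
qed

text \<open>Turns vanishing from a predicate into an equation, so that it can be rewritten and
  cancelled.\<close>

lemma is_zero_arr_iff:
  assumes "f \<in> Hom C A B"
  shows "is_zero_arr C f \<longleftrightarrow> f = zero_arr C A B"
  using zero_arr Hom_Obj[OF assms] is_zero_arr_unique assms by blast

lemma is_zero_arr_comp_left:
  assumes "is_zero_arr C g" "f \<in> Hom C A B" "g \<in> Hom C B D"
  shows "is_zero_arr C (g \<cdot> f)"
proof -
  obtain Z a b where g: "is_zero_obj C Z" "a \<in> Hom C B Z" "b \<in> Hom C Z D" "g = b \<cdot> a"
    using assms(1) unfolding is_zero_arr_def by (auto simp: Hom_Arr[OF assms(3)])
  then have "g \<cdot> f = b \<cdot> (a \<cdot> f)" "a \<cdot> f \<in> Hom C A Z" "g \<cdot> f \<in> Hom C A D"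
    using assms by (auto intro: Comp_in_Hom Comp_assoc)
  then show ?thesis
    using g(1,3) unfolding is_zero_arr_def by (auto simp: Hom_Arr)
qed

lemma is_zero_arr_comp_right:
  assumes "is_zero_arr C f" "f \<in> Hom C A B" "g \<in> Hom C B D"
  shows "is_zero_arr C (g \<cdot> f)"
proof -
  obtain Z a b where f: "is_zero_obj C Z" "a \<in> Hom C A Z" "b \<in> Hom C Z B" "f = b \<cdot> a"
    using assms(1) unfolding is_zero_arr_def by (auto simp: Hom_Arr[OF assms(2)])
  then have "g \<cdot> f = (g \<cdot> b) \<cdot> a" "g \<cdot> b \<in> Hom C Z D" "g \<cdot> f \<in> Hom C A D"
    using assms by (auto intro: Comp_in_Hom simp: Comp_assoc)
  then show ?thesis
    using f(1,2) unfolding is_zero_arr_def by (auto simp: Hom_Arr)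
qed

lemma zero_arr_comp:
  assumes "f \<in> Hom C A B" "D \<in> Obj C"
  shows "zero_arr C B D \<cdot> f = zero_arr C A D"
  using is_zero_arr_comp_left[OF is_zero_arr_zero_arr assms(1) zero_arr_in_Hom]
    is_zero_arr_iff[OF Comp_in_Hom[OF assms(1) zero_arr_in_Hom]] Hom_Obj[OF assms(1)] assms(2) by blast

lemma comp_zero_arr:
  assumes "f \<in> Hom C B D" "A \<in> Obj C"
  shows "f \<cdot> zero_arr C A B = zero_arr C A D"
  using is_zero_arr_comp_right[OF is_zero_arr_zero_arr zero_arr_in_Hom assms(1)]
    is_zero_arr_iff[OF Comp_in_Hom[OF zero_arr_in_Hom assms(1)]] Hom_Obj[OF assms(1)] assms(2) by blast

lemma to_zero_obj:
  assumes "f \<in> Hom C A (zero_obj C)"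
  shows "f = zero_arr C A (zero_obj C)"
  using is_zero_obj_zero_obj zero_arr(1) Hom_Obj[OF assms] assms
  unfolding is_zero_obj_def is_terminal_def by blast

lemma from_zero_obj:
  assumes "f \<in> Hom C (zero_obj C) B"
  shows "f = zero_arr C (zero_obj C) B"
  using is_zero_obj_zero_obj zero_arr(1) Hom_Obj[OF assms] assms
  unfolding is_zero_obj_def is_initial_def by blast

section \<open>Kernels and cokernels in a pointed category\<close>

lemma is_kernelI:
  assumes "f \<in> Hom C A B" "k \<in> Hom C K A" "f \<cdot> k = zero_arr C K B"
    and "\<And>T x. x \<in> Hom C T A \<Longrightarrow> f \<cdot> x = zero_arr C T B \<Longrightarrow> \<exists>u. u \<in> Hom C T K \<and> k \<cdot> u = x"
    and "is_mono C k"
  shows "is_kernel C f k"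
proof -
  have "\<exists>!u. u \<in> Hom C T K \<and> k \<cdot> u = x"
    if x: "x \<in> Hom C T A" "is_zero_arr C (f \<cdot> x)" for T x
    using assms(4)[OF x(1)] x(2) is_monoD[OF assms(5,2)]
    unfolding is_zero_arr_iff[OF Comp_in_Hom[OF x(1) assms(1)]] by metis
  then show ?thesis
    using assms(1-3) zero_arr(2) Hom_Obj[OF assms(1)] Hom_Obj[OF assms(2)] unfolding is_kernel_def
    by (simp add: Hom_Arr[OF assms(1)] Hom_Arr[OF assms(2)])
qed

lemma is_kernel_Hom:
  assumes "is_kernel C f k" "f \<in> Hom C A B"
  shows "k \<in> Hom C (Dom C k) A"
  using assms unfolding is_kernel_def by (simp add: Hom_Arr[OF assms(2)])

lemma is_kernel_comp:
  assumes "is_kernel C f k" "f \<in> Hom C A B" "k \<in> Hom C K A"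
  shows "f \<cdot> k = zero_arr C K B"
  using assms is_zero_arr_iff[OF Comp_in_Hom[OF assms(3,2)]] unfolding is_kernel_def by simp

lemma is_kernel_factor:
  assumes "is_kernel C f k" "f \<in> Hom C A B" "k \<in> Hom C K A"
    and "x \<in> Hom C T A" "f \<cdot> x = zero_arr C T B"
  obtains u where "u \<in> Hom C T K" "k \<cdot> u = x"
  using assms is_zero_arr_iff[OF Comp_in_Hom[OF assms(4,2)]] unfolding is_kernel_def
  by (simp add: Hom_Arr[OF assms(2)] Hom_Arr[OF assms(3)]) metis

text \<open>Since \<open>f\<close> kills \<open>k \<cdot> x\<close>, the uniqueness clause of the
  kernel applies to the factorizations of this arrow through \<open>k\<close>.\<close>

lemma is_kernel_mono:
  assumes "is_kernel C f k"
  shows "is_mono C k"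
proof -
  have f: "f \<in> Hom C (Dom C f) (Cod C f)" (is "_ \<in> Hom C ?A ?B")
    using assms by (auto simp: is_kernel_def Arr_Hom)
  note k = is_kernel_Hom[OF assms f]
  show ?thesis
  proof (rule is_monoI[OF k])
    fix T x y assume xy: "x \<in> Hom C T (Dom C k)" "y \<in> Hom C T (Dom C k)" "k \<cdot> x = k \<cdot> y"
    have "f \<cdot> (k \<cdot> x) = zero_arr C T ?B"
      using is_kernel_comp[OF assms f k] zero_arr_comp[OF xy(1) Hom_Obj(2)[OF f]]
        Comp_assoc[OF xy(1) k f] by simp
    then have "is_zero_arr C (f \<cdot> (k \<cdot> x))"
      using is_zero_arr_iff[OF Comp_in_Hom[OF Comp_in_Hom[OF xy(1) k] f]] by simp
    then have "\<exists>!u. u \<in> Hom C T (Dom C k) \<and> k \<cdot> u = k \<cdot> x"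
      using assms Comp_in_Hom[OF xy(1) k] unfolding is_kernel_def by blast
    then show "x = y"
      using xy by metis
  qed
qed

lemma is_cokernelI:
  assumes "f \<in> Hom C A B" "c \<in> Hom C B Q" "c \<cdot> f = zero_arr C A Q"
    and "\<And>T x. x \<in> Hom C B T \<Longrightarrow> x \<cdot> f = zero_arr C A T \<Longrightarrow> \<exists>u. u \<in> Hom C Q T \<and> u \<cdot> c = x"
    and "\<And>T x y. x \<in> Hom C Q T \<Longrightarrow> y \<in> Hom C Q T \<Longrightarrow> x \<cdot> c = y \<cdot> c \<Longrightarrow> x = y"
  shows "is_cokernel C f c"
proof -
  have "\<exists>!u. u \<in> Hom C Q T \<and> u \<cdot> c = x"
    if x: "x \<in> Hom C B T" "is_zero_arr C (x \<cdot> f)" for T x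
    using assms(4)[OF x(1)] x(2) assms(5)
    unfolding is_zero_arr_iff[OF Comp_in_Hom[OF assms(1) x(1)]] by metis
  then show ?thesis
    using assms(1-3) zero_arr(2) Hom_Obj[OF assms(1)] Hom_Obj[OF assms(2)] unfolding is_cokernel_def
    by (simp add: Hom_Arr[OF assms(1)] Hom_Arr[OF assms(2)])
qed

lemma is_cokernel_Hom:
  assumes "is_cokernel C f c" "f \<in> Hom C A B"
  shows "c \<in> Hom C B (Cod C c)"
  using assms unfolding is_cokernel_def by (simp add: Hom_Arr[OF assms(2)])

lemma is_cokernel_comp:
  assumes "is_cokernel C f c" "f \<in> Hom C A B" "c \<in> Hom C B Q"
  shows "c \<cdot> f = zero_arr C A Q"
  using assms is_zero_arr_iff[OF Comp_in_Hom[OF assms(2,3)]] unfolding is_cokernel_def by simp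

lemma is_cokernel_factor:
  assumes "is_cokernel C f c" "f \<in> Hom C A B" "c \<in> Hom C B Q"
    and "x \<in> Hom C B T" "x \<cdot> f = zero_arr C A T"
  obtains u where "u \<in> Hom C Q T" "u \<cdot> c = x"
  using assms is_zero_arr_iff[OF Comp_in_Hom[OF assms(2,4)]] unfolding is_cokernel_def
  by (simp add: Hom_Arr[OF assms(2)] Hom_Arr[OF assms(3)]) metis

text \<open>A cokernel of \<open>f\<close> is a coequalizer of \<open>f\<close> and the parallel
  zero arrow.\<close>

lemma is_regular_epi_if_cokernel:
  assumes "is_cokernel C f c"
  shows "is_regular_epi C c"
proof -
  have f: "f \<in> Hom C (Dom C f) (Cod C f)" (is "_ \<in> Hom C ?A ?B")
    using assms by (auto simp: is_cokernel_def Arr_Hom)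
  note c = is_cokernel_Hom[OF assms f]
  have z: "zero_arr C ?A ?B \<in> Hom C ?A ?B"
    using Hom_Obj[OF f] by (rule zero_arr)
  have "c \<cdot> f = c \<cdot> zero_arr C ?A ?B"
    using is_cokernel_comp[OF assms f c] comp_zero_arr[OF c Hom_Obj(1)[OF f]] by simp
  moreover have "is_zero_arr C (x \<cdot> f)"
    if "x \<in> Hom C ?B T" "x \<cdot> f = x \<cdot> zero_arr C ?A ?B" for T x
    using that comp_zero_arr[OF that(1) Hom_Obj(1)[OF f]] is_zero_arr_iff[OF Comp_in_Hom[OF f that(1)]]
    by simp
  ultimately have "is_coequalizer C f (zero_arr C ?A ?B) c"
    using Hom_Arr(1)[OF f] z c assms unfolding is_coequalizer_def is_cokernel_def by blast
  then show ?thesis unfolding is_regular_epi_def by blast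
qed

lemmas cokernel_cancel = regular_epi_cancel[OF is_regular_epi_if_cokernel]

lemma cokernel_unique:
  assumes "is_cokernel C f c" "is_cokernel C f c'"
  shows "isomorphic C (Cod C c) (Cod C c')"
proof -
  have f: "f \<in> Hom C (Dom C f) (Cod C f)" (is "_ \<in> Hom C ?A ?B")
    using assms(1) by (auto simp: is_cokernel_def Arr_Hom)
  note c = is_cokernel_Hom[OF assms(1) f] and c' = is_cokernel_Hom[OF assms(2) f]
  obtain u where u: "u \<in> Hom C (Cod C c) (Cod C c')" "u \<cdot> c = c'"
    using is_cokernel_factor[OF assms(1) f c c' is_cokernel_comp[OF assms(2) f c']] .
  obtain v where v: "v \<in> Hom C (Cod C c') (Cod C c)" "v \<cdot> c' = c"
    using is_cokernel_factor[OF assms(2) f c' c is_cokernel_comp[OF assms(1) f c]] .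
  have "(v \<cdot> u) \<cdot> c = Ident C (Cod C c) \<cdot> c" "(u \<cdot> v) \<cdot> c' = Ident C (Cod C c') \<cdot> c'"
    using Comp_assoc[OF c u(1) v(1)] Comp_assoc[OF c' v(1) u(1)] u(2) v(2)
      Ident_Comp[OF c] Ident_Comp[OF c'] by simp_all
  then have "v \<cdot> u = Ident C (Cod C c)" "u \<cdot> v = Ident C (Cod C c')"
    using cokernel_cancel[OF assms(1) c] cokernel_cancel[OF assms(2) c']
      Comp_in_Hom[OF u(1) v(1)] Comp_in_Hom[OF v(1) u(1)] Ident_in_Hom Hom_Obj[OF u(1)]
    by blast+
  then show ?thesis
    by (rule isomorphicI[OF u(1) v(1)])
qed

text \<open>Cokernels need not exist in a pointed category, so the choice \<open>cok\<close> is
  justified case by case, from any cokernel at hand.\<close>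

lemma is_cokernel_cok: "is_cokernel C f c \<Longrightarrow> is_cokernel C f (cok C f)"
  unfolding cok_def by (rule someI)

lemma Cok_isomorphic:
  assumes "is_cokernel C f c"
  shows "isomorphic C (Cok C f) (Cod C c)"
  unfolding Cok_def using cokernel_unique[OF is_cokernel_cok[OF assms] assms] .

lemma is_kernel_ker: "is_kernel C f k \<Longrightarrow> is_kernel C f (ker C f)"
  unfolding ker_def by (rule someI)

lemma colift_eqI:
  assumes "is_regular_epi C c" "c \<in> Hom C A Q" "u \<in> Hom C Q B" "u \<cdot> c = f"
  shows "colift C c f = u"
proof -
  have "Cod C f = B"
    using Comp_in_Hom[OF assms(2,3)] assms(4) by (simp add: Hom_Arr)
  then show ?thesis
    unfolding colift_def Hom_Arr[OF assms(2)]
    using assms regular_epi_cancel[OF assms(1,2)] by (intro the_equality) auto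
qed

lemma mono_zero_cancel:
  assumes "is_mono C m" "m \<in> Hom C A B" "x \<in> Hom C T A" "m \<cdot> x = zero_arr C T B"
  shows "x = zero_arr C T A"
  using is_monoD[OF assms(1-3) zero_arr_in_Hom] comp_zero_arr[OF assms(2)] assms(3,4) Hom_Obj by metis

text \<open>As \<open>e\<close> is epi, an arrow kills \<open>j \<cdot> e\<close> exactly when it
  kills \<open>j\<close>. This allows a differential to be exchanged for its image wherever only a
  cokernel is concerned.\<close>

lemma is_cokernel_comp_epi_iff:
  assumes "is_regular_epi C e" "e \<in> Hom C A I" "j \<in> Hom C I K"
  shows "is_cokernel C (j \<cdot> e) c \<longleftrightarrow> is_cokernel C j c"
proof -
  note je = Comp_in_Hom[OF assms(2,3)]
  have "is_zero_arr C (x \<cdot> (j \<cdot> e)) \<longleftrightarrow> is_zero_arr C (x \<cdot> j)" if x: "x \<in> Hom C K T" for x T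
  proof -
    have "x \<cdot> (j \<cdot> e) = (x \<cdot> j) \<cdot> e" using Comp_assoc[OF assms(2,3) x] by simp
    moreover have "(x \<cdot> j) \<cdot> e = zero_arr C A T \<longleftrightarrow> x \<cdot> j = zero_arr C I T"
      using regular_epi_cancel[OF assms(1,2) Comp_in_Hom[OF assms(3) x] zero_arr_in_Hom]
        zero_arr_comp[OF assms(2) Hom_Obj(2)[OF x]] Hom_Obj[OF assms(3)] Hom_Obj[OF x] by auto
    ultimately show ?thesis
      using is_zero_arr_iff[OF Comp_in_Hom[OF je x]] is_zero_arr_iff[OF Comp_in_Hom[OF assms(3) x]]
      by simp
  qed
  then show ?thesis
    unfolding is_cokernel_def Hom_Arr(3)[OF je] Hom_Arr(3)[OF assms(3)]
    using Hom_Arr(1)[OF je] Hom_Arr(1)[OF assms(3)] by blast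
qed

text \<open>If \<open>m\<close> is a kernel of \<open>f\<close>, then \<open>f\<close> factors
  through \<open>q\<close>, so whatever \<open>q\<close> kills is killed by \<open>f\<close> and
  factors through \<open>m\<close>.\<close>

lemma normal_mono_is_kernel_of_cokernel:
  assumes "is_normal_mono C m" "is_cokernel C m q"
  shows "is_kernel C q m"
proof -
  obtain f where f: "is_kernel C f m"
    using assms(1) unfolding is_normal_mono_def by blast
  then have fH: "f \<in> Hom C (Dom C f) (Cod C f)" (is "_ \<in> Hom C ?A ?B")
    by (simp add: is_kernel_def Arr_Hom)
  note m = is_kernel_Hom[OF f fH]
  note q = is_cokernel_Hom[OF assms(2) m]
  obtain t where t: "t \<in> Hom C (Cod C q) ?B" "t \<cdot> q = f"
    using is_cokernel_factor[OF assms(2) m q fH is_kernel_comp[OF f fH m]] .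
  show ?thesis
  proof (rule is_kernelI[OF q m is_cokernel_comp[OF assms(2) m q] _ is_kernel_mono[OF f]])
    fix T x assume x: "x \<in> Hom C T ?A" "q \<cdot> x = zero_arr C T (Cod C q)"
    have "f \<cdot> x = zero_arr C T ?B"
      using Comp_assoc[OF x(1) q t(1)] x(2) t(2) comp_zero_arr[OF t(1) Hom_Obj(1)[OF x(1)]] by simp
    then show "\<exists>u. u \<in> Hom C T (Dom C m) \<and> m \<cdot> u = x"
      using is_kernel_factor[OF f fH m x(1)] by blast
  qed
qed

end


section \<open>Regular epimorphisms and images\<close>

context finitely_complete_category
begin

text \<open>A product is a pullback over a terminal object.\<close>

lemma product_exists:
  assumes "A \<in> Obj C" "B \<in> Obj C"
  shows "\<exists>P. \<exists>p \<in> Hom C P A. \<exists>q \<in> Hom C P B. \<forall>T. \<forall>x \<in> Hom C T A. \<forall>y \<in> Hom C T B.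
    \<exists>!u. u \<in> Hom C T P \<and> p \<cdot> u = x \<and> q \<cdot> u = y"
proof -
  obtain Z where Z: "is_terminal C Z" using has_terminal by blast
  then obtain a b where ab: "a \<in> Hom C A Z" "b \<in> Hom C B Z"
    using assms unfolding is_terminal_def by blast
  obtain p q where pq: "is_pullback C a b p q" using has_pullbacks ab by blast
  note h = is_pullback_Hom[OF pq ab]
  have "a \<cdot> x = b \<cdot> y" if "x \<in> Hom C T A" "y \<in> Hom C T B" for T x y
    using Z Comp_in_Hom[OF that(1) ab(1)] Comp_in_Hom[OF that(2) ab(2)] Hom_Obj[OF that(1)]
    unfolding is_terminal_def by blast
  then have "\<exists>!u. u \<in> Hom C T (Dom C p) \<and> p \<cdot> u = x \<and> q \<cdot> u = y"
    if "x \<in> Hom C T A" "y \<in> Hom C T B" for T x y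
    using pq[unfolded is_pullback_iff[OF ab h]] that by simp
  then show ?thesis
    using h by (intro exI[of _ "Dom C p"] bexI[of _ p] bexI[of _ q]) auto
qed

text \<open>The equalizer is the pullback of the graphs \<open>F = (1, f)\<close> and
  \<open>G = (1, g)\<close>, both arrows from \<open>A\<close> into the product of \<open>A\<close>
  and \<open>B\<close>.\<close>

lemma equalizer_exists:
  assumes "f \<in> Hom C A B" "g \<in> Hom C A B"
  shows "\<exists>E. \<exists>n \<in> Hom C E A. is_mono C n \<and> f \<cdot> n = g \<cdot> n \<and>
    (\<forall>T. \<forall>x \<in> Hom C T A. f \<cdot> x = g \<cdot> x \<longrightarrow> (\<exists>u \<in> Hom C T E. n \<cdot> u = x))"
proof -
  obtain P p q where P: "p \<in> Hom C P A" "q \<in> Hom C P B"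
    and univ: "\<And>T x y. x \<in> Hom C T A \<Longrightarrow> y \<in> Hom C T B \<Longrightarrow>
      \<exists>!u. u \<in> Hom C T P \<and> p \<cdot> u = x \<and> q \<cdot> u = y"
    using product_exists[OF Hom_Obj[OF assms(1)]] by blast
  note i = Ident_in_Hom[OF Hom_Obj(1)[OF assms(1)]]
  obtain F where F: "F \<in> Hom C A P" "p \<cdot> F = Ident C A" "q \<cdot> F = f" using univ[OF i assms(1)] by blast
  obtain G where G: "G \<in> Hom C A P" "p \<cdot> G = Ident C A" "q \<cdot> G = g" using univ[OF i assms(2)] by blast
  obtain a b where pb: "is_pullback C F G a b" using has_pullbacks F G by blast
  note ab = is_pullback_Hom[OF pb F(1) G(1)]
  have FG: "F \<cdot> a = G \<cdot> b" using pb by (rule is_pullback_commute)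
  \<comment> \<open>The first components of the graphs are identities, which forces the two legs of
    the pullback to coincide.\<close>
  have "a = b"
    using Comp_assoc[OF ab(1) F(1) P(1)] Comp_assoc[OF ab(2) G(1) P(1)] FG F(2) G(2)
      Ident_Comp[OF ab(1)] Ident_Comp[OF ab(2)] by simp
  have fg: "f \<cdot> a = g \<cdot> a"
    using Comp_assoc[OF ab(1) F(1) P(2)] Comp_assoc[OF ab(2) G(1) P(2)] FG F(3) G(3) \<open>a = b\<close> by simp
  have mono: "is_mono C a"
    using is_pullback_cancel[OF pb F(1) G(1)] \<open>a = b\<close> by (intro is_monoI[OF ab(1)]) blast
  have "\<exists>u \<in> Hom C T (Dom C a). a \<cdot> u = x" if x: "x \<in> Hom C T A" "f \<cdot> x = g \<cdot> x" for T x
  proof -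
    have "p \<cdot> (F \<cdot> x) = p \<cdot> (G \<cdot> x)" "q \<cdot> (F \<cdot> x) = q \<cdot> (G \<cdot> x)"
      using Comp_assoc[OF x(1) F(1) P(1)] Comp_assoc[OF x(1) G(1) P(1)]
        Comp_assoc[OF x(1) F(1) P(2)] Comp_assoc[OF x(1) G(1) P(2)] F(2,3) G(2,3) x(2) by simp_all
    then have "F \<cdot> x = G \<cdot> x"
      using univ[OF Comp_in_Hom[OF Comp_in_Hom[OF x(1) F(1)] P(1)]
          Comp_in_Hom[OF Comp_in_Hom[OF x(1) F(1)] P(2)]]
        Comp_in_Hom[OF x(1) F(1)] Comp_in_Hom[OF x(1) G(1)] by metis
    then show ?thesis
      using is_pullback_factor[OF pb F(1) G(1) x(1) x(1)] by metis
  qed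
  then show ?thesis using ab(1) fg mono by blast
qed

end

context regular_category
begin

text \<open>The image is the coequalizer \<open>e\<close> of the kernel pair of \<open>f\<close>.
  The point is that the induced \<open>m\<close> is mono, which rests on stability of regular
  epimorphisms.\<close>

lemma regular_image_exists:
  assumes f: "f \<in> Hom C A B"
  shows "\<exists>I. \<exists>e \<in> Hom C A I. \<exists>m \<in> Hom C I B. is_regular_epi C e \<and> is_mono C m \<and> m \<cdot> e = f"
proof -
  obtain r s where rs: "is_pullback C f f r s" using has_pullbacks[OF f f] by blast
  note rsH = is_pullback_Hom[OF rs f f]
  obtain e where e: "is_coequalizer C r s e" using kernel_pairs_have_coequalizers[OF rs] by blast
  define I where "I = Cod C e"
  have eH: "e \<in> Hom C A I"
    using e rsH unfolding is_coequalizer_def I_def by (simp add: Hom_Arr(3)[OF rsH(1)])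
  have e_reg: "is_regular_epi C e" using e unfolding is_regular_epi_def by blast
  have ers: "e \<cdot> r = e \<cdot> s" using e by (rule is_coequalizer_commute)
  obtain m where m: "m \<in> Hom C I B" "m \<cdot> e = f"
    using is_coequalizer_factor[OF e eH f is_pullback_commute[OF rs]] by blast
  have "is_mono C m"
  proof (rule is_monoI[OF m(1)])
    fix T a b assume a: "a \<in> Hom C T I" and b: "b \<in> Hom C T I" and ab: "m \<cdot> a = m \<cdot> b"
    \<comment> \<open>Arrows \<open>a\<close> and \<open>b\<close> into \<open>I\<close> need not
      lift along \<open>e\<close>. Pulling \<open>e\<close> back along \<open>a\<close>, then along
      \<open>b \<cdot> q\<close>, makes both lift after restriction along the regular epimorphisms
      \<open>q\<close> and \<open>q'\<close>; the lifts are \<open>p \<cdot> q'\<close> and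
      \<open>p'\<close>.\<close>
    obtain p q where pb1: "is_pullback C e a p q" using has_pullbacks[OF eH a] by blast
    define P where "P = Dom C p"
    have p: "p \<in> Hom C P A" and q: "q \<in> Hom C P T"
      using is_pullback_Hom[OF pb1 eH a] unfolding P_def by auto
    have q_reg: "is_regular_epi C q" using regular_epis_stable[OF e_reg pb1] .
    have ep: "e \<cdot> p = a \<cdot> q" using pb1 by (rule is_pullback_commute)
    have bq: "b \<cdot> q \<in> Hom C P I" using Comp_in_Hom[OF q b] .
    obtain p' q' where pb2: "is_pullback C e (b \<cdot> q) p' q'" using has_pullbacks[OF eH bq] by blast
    define P' where "P' = Dom C p'"
    have p': "p' \<in> Hom C P' A" and q': "q' \<in> Hom C P' P"
      using is_pullback_Hom[OF pb2 eH bq] unfolding P'_def by auto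
    have q'_reg: "is_regular_epi C q'" using regular_epis_stable[OF e_reg pb2] .
    have ep': "e \<cdot> p' = (b \<cdot> q) \<cdot> q'" using pb2 by (rule is_pullback_commute)
    note pq' = Comp_in_Hom[OF q' p]
    have epq: "e \<cdot> (p \<cdot> q') = (a \<cdot> q) \<cdot> q'"
      using Comp_assoc[OF q' p eH] ep by simp
    have maq: "m \<cdot> ((a \<cdot> q) \<cdot> q') = m \<cdot> ((b \<cdot> q) \<cdot> q')"
      using Comp_assoc[OF q' Comp_in_Hom[OF q a] m(1)] Comp_assoc[OF q' bq m(1)]
        Comp_assoc[OF q a m(1)] Comp_assoc[OF q b m(1)] ab by simp
    \<comment> \<open>Having the same image under \<open>f\<close>, the two lifts form an arrow into
      the kernel pair, whose projections are coequalized by \<open>e\<close>.\<close>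
    have "f \<cdot> (p \<cdot> q') = f \<cdot> p'"
      using Comp_assoc[OF pq' eH m(1)] Comp_assoc[OF p' eH m(1)] m(2) epq ep' maq by simp
    then obtain w where w: "w \<in> Hom C P' (Dom C r)" "r \<cdot> w = p \<cdot> q'" "s \<cdot> w = p'"
      using is_pullback_factor[OF rs f f pq' p'] by metis
    have "e \<cdot> (p \<cdot> q') = e \<cdot> p'"
      using Comp_assoc[OF w(1) rsH(1) eH] Comp_assoc[OF w(1) rsH(2) eH] w ers by simp
    then have "(a \<cdot> q) \<cdot> q' = (b \<cdot> q) \<cdot> q'" using epq ep' by simp
    then have "a \<cdot> q = b \<cdot> q"
      by (rule regular_epi_cancel[OF q'_reg q' Comp_in_Hom[OF q a] bq])
    then show "a = b" by (rule regular_epi_cancel[OF q_reg q a b])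
  qed
  then show ?thesis using eH m e_reg by blast
qed

end

section \<open>Kernels, normal epimorphisms and factorizations in a semi-abelian category\<close>

sublocale semi_abelian_category \<subseteq> pointed_category
  by unfold_locales (rule has_zero_obj)

context semi_abelian_category
begin

text \<open>The kernel is the pullback of \<open>f\<close> along the arrow from the zero object. The
  second leg carries no information, as arrows into the zero object are unique.\<close>

lemma kernel_exists:
  assumes f: "f \<in> Hom C A B"
  shows "\<exists>k. is_kernel C f k"
proof -
  note z = zero_arr_in_Hom[OF zero_obj_in_Obj Hom_Obj(2)[OF f]]
  obtain p q where pb: "is_pullback C f (zero_arr C (zero_obj C) B) p q" using has_pullbacks[OF f z] by blast
  note pq = is_pullback_Hom[OF pb f z]
  have q: "u = v" if "u \<in> Hom C T (zero_obj C)" "v \<in> Hom C T (zero_obj C)" for T u v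
    using to_zero_obj[OF that(1)] to_zero_obj[OF that(2)] by simp
  have "f \<cdot> p = zero_arr C (Dom C p) B"
    using is_pullback_commute[OF pb] zero_arr_comp[OF pq(2) Hom_Obj(2)[OF f]] by simp
  moreover have "is_mono C p"
    using is_pullback_cancel[OF pb f z] q Comp_in_Hom[OF _ pq(2)] by (intro is_monoI[OF pq(1)]) blast
  moreover have "\<exists>u. u \<in> Hom C T (Dom C p) \<and> p \<cdot> u = x"
    if x: "x \<in> Hom C T A" "f \<cdot> x = zero_arr C T B" for T x
  proof -
    note y = zero_arr_in_Hom[OF Hom_Obj(1)[OF x(1)] zero_obj_in_Obj]
    have "f \<cdot> x = zero_arr C (zero_obj C) B \<cdot> zero_arr C T (zero_obj C)"
      using x(2) zero_arr_comp[OF y Hom_Obj(2)[OF f]] by simp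
    then show ?thesis using is_pullback_factor[OF pb f z x(1) y] by blast
  qed
  ultimately show ?thesis using is_kernelI[OF f pq(1)] by blast
qed

lemma is_kernel_ker_Hom: "f \<in> Hom C A B \<Longrightarrow> is_kernel C f (ker C f)"
  using kernel_exists is_kernel_ker by blast

text \<open>Pulling a point back along the zero morphism yields its kernel, so protomodularity says that
  the section and the kernel of a point are jointly extremally epimorphic.\<close>

lemma mono_containing_section_and_kernel_is_iso:
  assumes s: "s \<in> Hom C R A" and d: "d \<in> Hom C A R" and sd: "s \<cdot> d = Ident C A"
    and \<kappa>: "is_kernel C s \<kappa>" "\<kappa> \<in> Hom C K R"
    and n: "n \<in> Hom C E R" "is_mono C n"
    and d': "d' \<in> Hom C A E" "n \<cdot> d' = d"
    and \<kappa>': "\<kappa>' \<in> Hom C K E" "n \<cdot> \<kappa>' = \<kappa>"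
  shows "is_iso C n"
proof -
  let ?z = "zero_arr C (zero_obj C) A"
  note z = zero_arr_in_Hom[OF zero_obj_in_Obj Hom_Obj(2)[OF s]]
  note sn = Comp_in_Hom[OF n(1) s]
  obtain p1 p2 where pb1: "is_pullback C (s \<cdot> n) ?z p1 p2" using has_pullbacks[OF sn z] by blast
  obtain q1 q2 where pb2: "is_pullback C s ?z q1 q2" using has_pullbacks[OF s z] by blast
  note p = is_pullback_Hom[OF pb1 sn z] and q = is_pullback_Hom[OF pb2 s z]
  note cp = is_pullback_commute[OF pb1] and cq = is_pullback_commute[OF pb2]
  have "s \<cdot> (n \<cdot> p1) = ?z \<cdot> p2" using Comp_assoc[OF p(1) n(1) s] cp by simp
  then obtain u where u: "u \<in> Hom C (Dom C p1) (Dom C q1)" "q1 \<cdot> u = n \<cdot> p1" "q2 \<cdot> u = p2"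
    using is_pullback_factor[OF pb2 s z Comp_in_Hom[OF p(1) n(1)] p(2)] by blast
  \<comment> \<open>Towards an inverse of \<open>u\<close>: \<open>q1\<close> is killed by
    \<open>s\<close>, hence factors through \<open>\<kappa>\<close>, and \<open>\<kappa>\<close>
    factors through \<open>n\<close> by assumption.\<close>
  have "s \<cdot> q1 = zero_arr C (Dom C q1) A" using cq zero_arr_comp[OF q(2) Hom_Obj(2)[OF s]] by simp
  then obtain y where y: "y \<in> Hom C (Dom C q1) K" "\<kappa> \<cdot> y = q1"
    using is_kernel_factor[OF \<kappa>(1) s \<kappa>(2) q(1)] by blast
  note \<kappa>y = Comp_in_Hom[OF y(1) \<kappa>'(1)]
  have n\<kappa>y: "n \<cdot> (\<kappa>' \<cdot> y) = q1" using Comp_assoc[OF y(1) \<kappa>'(1) n(1)] \<kappa>'(2) y(2) by simp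
  have "(s \<cdot> n) \<cdot> (\<kappa>' \<cdot> y) = ?z \<cdot> q2" using Comp_assoc[OF \<kappa>y n(1) s] n\<kappa>y cq by simp
  then obtain v where v: "v \<in> Hom C (Dom C q1) (Dom C p1)" "p1 \<cdot> v = \<kappa>' \<cdot> y" "p2 \<cdot> v = q2"
    using is_pullback_factor[OF pb1 sn z \<kappa>y q(2)] by blast
  note uv = Comp_in_Hom[OF v(1) u(1)] and vu = Comp_in_Hom[OF u(1) v(1)]
  note ip = Ident_in_Hom[OF Hom_Obj(1)[OF p(1)]] and iq = Ident_in_Hom[OF Hom_Obj(1)[OF q(1)]]
  have "q1 \<cdot> (u \<cdot> v) = q1 \<cdot> Ident C (Dom C q1)" "q2 \<cdot> (u \<cdot> v) = q2 \<cdot> Ident C (Dom C q1)"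
    using Comp_assoc[OF v(1) u(1) q(1)] Comp_assoc[OF v(1) u(1) q(2)] u(2,3) v(2,3)
      Comp_assoc[OF v(1) p(1) n(1)] n\<kappa>y Comp_Ident[OF q(1)] Comp_Ident[OF q(2)] by simp_all
  then have 1: "u \<cdot> v = Ident C (Dom C q1)"
    by (rule is_pullback_cancel[OF pb2 s z uv iq])
  have "n \<cdot> (p1 \<cdot> (v \<cdot> u)) = n \<cdot> p1"
    using Comp_assoc[OF vu p(1) n(1)] Comp_assoc[OF u(1) v(1) p(1)] v(2)
      Comp_assoc[OF u(1) \<kappa>y n(1)] n\<kappa>y u(2) by simp
  then have "p1 \<cdot> (v \<cdot> u) = p1"
    by (rule is_monoD[OF n(2,1) Comp_in_Hom[OF vu p(1)] p(1)])
  moreover have "p2 \<cdot> (v \<cdot> u) = p2"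
    using Comp_assoc[OF u(1) v(1) p(2)] v(3) u(3) by simp
  ultimately have "v \<cdot> u = Ident C (Dom C p1)"
    using is_pullback_cancel[OF pb1 sn z vu ip] Comp_Ident[OF p(1)] Comp_Ident[OF p(2)] by simp
  then have "is_iso C u" using 1 by (rule is_isoI[OF u(1) v(1)])
  moreover have "(s \<cdot> n) \<cdot> d' = Ident C A" using Comp_assoc[OF d'(1) n(1) s] d'(2) sd by simp
  \<comment> \<open>Protomodularity is applied to \<open>n\<close> as a morphism of points over
    \<open>A\<close>, from \<open>(s \<cdot> n, d')\<close> to \<open>(s, d)\<close>, with change of
    base along the zero arrow.\<close>
  ultimately show ?thesis
    using protomodular[unfolded is_protomodular_def, rule_format,
        of "s \<cdot> n" E A d' s R d n "?z" p1 p2 q1 q2 u]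
      sn s d sd d' n(1) pb1 pb2 u by blast
qed

text \<open>Let \<open>x\<close> kill the kernel \<open>k\<close>. The equalizer of
  \<open>x \<cdot> r\<close> and \<open>x \<cdot> s\<close> on the kernel pair of \<open>e\<close>
  contains the diagonal and the kernel of \<open>s\<close>, hence is the whole kernel pair by the
  preceding lemma. So \<open>x\<close> coequalizes the kernel pair and factors through
  \<open>e\<close>.\<close>

lemma regular_epi_is_cokernel_of_kernel:
  assumes e: "is_regular_epi C e" "e \<in> Hom C A B" and k: "is_kernel C e k"
  shows "is_cokernel C k e"
proof -
  obtain g h where c: "is_coequalizer C g h e" using e(1) unfolding is_regular_epi_def by blast
  note gh = is_coequalizer_Hom[OF c e(2)]
  define K where "K = Dom C k"
  have kH: "k \<in> Hom C K A" using is_kernel_Hom[OF k e(2)] unfolding K_def .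
  have ek: "e \<cdot> k = zero_arr C K B" using is_kernel_comp[OF k e(2) kH] .
  have A: "A \<in> Obj C" and B: "B \<in> Obj C" and K: "K \<in> Obj C"
    using Hom_Obj[OF e(2)] Hom_Obj[OF kH] by auto
  obtain r s where rs: "is_pullback C e e r s" using has_pullbacks[OF e(2) e(2)] by blast
  define R where "R = Dom C r"
  have r: "r \<in> Hom C R A" and s: "s \<in> Hom C R A"
    using is_pullback_Hom[OF rs e(2) e(2)] unfolding R_def by auto
  have ers: "e \<cdot> r = e \<cdot> s" using rs by (rule is_pullback_commute)
  note factor = is_pullback_factor[OF rs e(2) e(2), folded R_def]
  obtain d where d: "d \<in> Hom C A R" "r \<cdot> d = Ident C A" "s \<cdot> d = Ident C A"
    using factor[OF Ident_in_Hom[OF A] Ident_in_Hom[OF A]] by blast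
  \<comment> \<open>\<open>e\<close> is only known to coequalize some pair \<open>g\<close>,
    \<open>h\<close>. This pair factors through the kernel pair, so agreement on \<open>r\<close>
    and \<open>s\<close> will be enough.\<close>
  obtain w where w: "w \<in> Hom C (Dom C g) R" "r \<cdot> w = g" "s \<cdot> w = h"
    using factor[OF gh is_coequalizer_commute[OF c]] by blast
  \<comment> \<open>\<open>\<kappa>\<close> is the pair \<open>(k, 0)\<close> in the kernel pair. It
    is shown to be a kernel of the second projection \<open>s\<close>, which the diagonal
    \<open>d\<close> splits.\<close>
  have "e \<cdot> k = e \<cdot> zero_arr C K A" using ek comp_zero_arr[OF e(2) K] by simp
  then obtain \<kappa> where \<kappa>: "\<kappa> \<in> Hom C K R" "r \<cdot> \<kappa> = k" "s \<cdot> \<kappa> = zero_arr C K A"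
    using factor[OF kH zero_arr_in_Hom[OF K A]] by blast
  have "is_mono C \<kappa>" using mono_factor[OF _ \<kappa>(1) r] \<kappa>(2) is_kernel_mono[OF k] by simp
  have ker\<kappa>: "is_kernel C s \<kappa>"
  proof (rule is_kernelI[OF s \<kappa>(1,3) _ \<open>is_mono C \<kappa>\<close>])
    fix T y assume y: "y \<in> Hom C T R" "s \<cdot> y = zero_arr C T A"
    have "e \<cdot> (r \<cdot> y) = zero_arr C T B"
      using Comp_assoc[OF y(1) r e(2)] Comp_assoc[OF y(1) s e(2)] ers y(2)
        comp_zero_arr[OF e(2) Hom_Obj(1)[OF y(1)]] by simp
    then obtain u where u: "u \<in> Hom C T K" "k \<cdot> u = r \<cdot> y"
      using is_kernel_factor[OF k e(2) kH Comp_in_Hom[OF y(1) r]] by blast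
    have "r \<cdot> (\<kappa> \<cdot> u) = r \<cdot> y" "s \<cdot> (\<kappa> \<cdot> u) = s \<cdot> y"
      using Comp_assoc[OF u(1) \<kappa>(1) r] Comp_assoc[OF u(1) \<kappa>(1) s] \<kappa>(2,3) u(2) y(2)
        zero_arr_comp[OF u(1) A] by simp_all
    then have "\<kappa> \<cdot> u = y"
      by (rule is_pullback_cancel[OF rs e(2) e(2), folded R_def, OF Comp_in_Hom[OF u(1) \<kappa>(1)] y(1)])
    with u(1) show "\<exists>u. u \<in> Hom C T K \<and> \<kappa> \<cdot> u = y" by blast
  qed
  show ?thesis
  proof (rule is_cokernelI[OF kH e(2) ek])
    fix T x assume x: "x \<in> Hom C A T" and xk: "x \<cdot> k = zero_arr C K T"
    note xr = Comp_in_Hom[OF r x] and xs = Comp_in_Hom[OF s x]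
    obtain E n where n: "n \<in> Hom C E R" "is_mono C n" "(x \<cdot> r) \<cdot> n = (x \<cdot> s) \<cdot> n"
      and nu: "\<And>T y. y \<in> Hom C T R \<Longrightarrow> (x \<cdot> r) \<cdot> y = (x \<cdot> s) \<cdot> y \<Longrightarrow> \<exists>u \<in> Hom C T E. n \<cdot> u = y"
      using equalizer_exists[OF xr xs] by blast
    have "(x \<cdot> r) \<cdot> d = (x \<cdot> s) \<cdot> d"
      using Comp_assoc[OF d(1) r x] Comp_assoc[OF d(1) s x] d(2,3) by simp
    then obtain d' where d': "d' \<in> Hom C A E" "n \<cdot> d' = d" using nu[OF d(1)] by blast
    have "(x \<cdot> r) \<cdot> \<kappa> = (x \<cdot> s) \<cdot> \<kappa>"
      using Comp_assoc[OF \<kappa>(1) r x] Comp_assoc[OF \<kappa>(1) s x] \<kappa>(2,3) xk comp_zero_arr[OF x K] by simp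
    then obtain \<kappa>' where \<kappa>': "\<kappa>' \<in> Hom C K E" "n \<cdot> \<kappa>' = \<kappa>" using nu[OF \<kappa>(1)] by blast
    have "is_iso C n"
      by (rule mono_containing_section_and_kernel_is_iso[OF s d(1,3) ker\<kappa> \<kappa>(1) n(1,2) d' \<kappa>'])
    then obtain n' where n': "n' \<in> Hom C R E" "n \<cdot> n' = Ident C R" using n(1) by (rule is_isoE)
    have "x \<cdot> r = x \<cdot> s"
      using arg_cong[OF n(3), of "\<lambda>y. y \<cdot> n'"]
      unfolding Comp_assoc[OF n'(1) n(1) xr] Comp_assoc[OF n'(1) n(1) xs] n'(2)
        Comp_Ident[OF xr] Comp_Ident[OF xs] .
    then have "x \<cdot> g = x \<cdot> h"
      using Comp_assoc[OF w(1) r x] Comp_assoc[OF w(1) s x] w(2,3) by simp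
    then show "\<exists>u. u \<in> Hom C B T \<and> u \<cdot> e = x"
      using is_coequalizer_factor[OF c e(2) x] by blast
  qed (rule regular_epi_cancel[OF e])
qed

lemma factorization_exists:
  assumes f: "f \<in> Hom C A B"
  shows "\<exists>e m. is_factorization C f e m"
proof -
  obtain I e m where em: "e \<in> Hom C A I" "m \<in> Hom C I B" "is_regular_epi C e" "is_mono C m" "m \<cdot> e = f"
    using regular_image_exists[OF f] by blast
  have "is_normal_epi C e"
    using regular_epi_is_cokernel_of_kernel[OF em(3,1) is_kernel_ker_Hom[OF em(1)]]
    unfolding is_normal_epi_def by blast
  then show ?thesis
    using em f Hom_Arr[OF f] Hom_Arr[OF em(2)] unfolding is_factorization_def by auto
qed

lemma is_factorization_img:
  assumes "f \<in> Hom C A B"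
  shows "is_factorization C f (img_epi C f) (img_mono C f)"
proof -
  have "\<exists>x. case x of (e, m) \<Rightarrow> is_factorization C f e m"
    using factorization_exists[OF assms] by auto
  then have "case img C f of (e, m) \<Rightarrow> is_factorization C f e m"
    unfolding img_def by (rule someI_ex)
  then show ?thesis
    by (simp add: img_epi_def img_mono_def case_prod_beta)
qed

lemma is_factorization_regular_epi: "is_factorization C f e m \<Longrightarrow> is_regular_epi C e"
  unfolding is_factorization_def is_normal_epi_def using is_regular_epi_if_cokernel by blast

text \<open>Write the arrow with kernel \<open>m\<close> as a regular epi \<open>e\<close> followed
  by a mono. The mono does not affect the kernel, so \<open>m\<close> is a kernel of
  \<open>e\<close>, and \<open>e\<close> is a cokernel of its kernel.\<close>

lemma normal_mono_cokernel_exists: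
  assumes "is_normal_mono C m"
  shows "\<exists>q. is_cokernel C m q"
proof -
  obtain f where f: "is_kernel C f m"
    using assms(1) unfolding is_normal_mono_def by blast
  then have fH: "f \<in> Hom C (Dom C f) (Cod C f)" (is "_ \<in> Hom C ?A ?B")
    by (simp add: is_kernel_def Arr_Hom)
  note m = is_kernel_Hom[OF f fH]
  obtain I e i where ei: "e \<in> Hom C ?A I" "i \<in> Hom C I ?B" "is_regular_epi C e" "is_mono C i" "i \<cdot> e = f"
    using regular_image_exists[OF fH] by blast
  have "i \<cdot> (e \<cdot> m) = zero_arr C (Dom C m) ?B"
    using Comp_assoc[OF m ei(1,2)] ei(5) is_kernel_comp[OF f fH m] by simp
  then have em: "e \<cdot> m = zero_arr C (Dom C m) I"
    by (rule mono_zero_cancel[OF ei(4,2) Comp_in_Hom[OF m ei(1)]])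
  have "is_kernel C e m"
  proof (rule is_kernelI[OF ei(1) m em _ is_kernel_mono[OF f]])
    fix T x assume x: "x \<in> Hom C T ?A" "e \<cdot> x = zero_arr C T I"
    have "f \<cdot> x = zero_arr C T ?B"
      using Comp_assoc[OF x(1) ei(1,2)] ei(5) x(2) comp_zero_arr[OF ei(2) Hom_Obj(1)[OF x(1)]] by simp
    then show "\<exists>u. u \<in> Hom C T (Dom C m) \<and> m \<cdot> u = x"
      using is_kernel_factor[OF f fH m x(1)] by blast
  qed
  then show ?thesis using regular_epi_is_cokernel_of_kernel[OF ei(3,1)] by blast
qed

end


section \<open>The homology object of a composable pair\<close>

text \<open>Two consecutive differentials detached from their complex, which keeps degrees out of
  the argument; \<open>factorization\<close> and \<open>normal\<close> express that
  \<open>d'\<close> is proper.\<close>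

locale proper_pair = semi_abelian_category +
  fixes A' A B and d' d e m
  assumes d': "d' \<in> Hom C A' A" and d: "d \<in> Hom C A B"
    and dd': "d \<cdot> d' = zero_arr C A' B"
    and factorization: "is_factorization C d' e m"
    and normal: "is_normal_mono C m"
begin

abbreviation I where "I \<equiv> Dom C m"
abbreviation k where "k \<equiv> ker C d"
abbreviation K where "K \<equiv> Ker C d"

lemma e_regular: "is_regular_epi C e"
  using factorization by (rule is_factorization_regular_epi)

lemma e: "e \<in> Hom C A' I" and m: "m \<in> Hom C I A" and m_mono: "is_mono C m" and me: "m \<cdot> e = d'"
  using factorization unfolding is_factorization_def by (auto simp: Hom_Arr(2,3)[OF d'])

lemma k_kernel: "is_kernel C d k"
  using d by (rule is_kernel_ker_Hom)

lemma k: "k \<in> Hom C K A" and k_mono: "is_mono C k" and dk: "d \<cdot> k = zero_arr C K B"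
  using is_kernel_Hom[OF k_kernel d] is_kernel_mono[OF k_kernel] is_kernel_comp[OF k_kernel d]
  unfolding Ker_def by auto

lemma dm: "d \<cdot> m = zero_arr C I B"
proof (rule regular_epi_cancel[OF e_regular e Comp_in_Hom[OF m d] zero_arr_in_Hom])
  show "I \<in> Obj C" "B \<in> Obj C" using Hom_Obj[OF m] Hom_Obj[OF d] by auto
  show "(d \<cdot> m) \<cdot> e = zero_arr C I B \<cdot> e"
    using Comp_assoc[OF e m d] me dd' zero_arr_comp[OF e \<open>B \<in> Obj C\<close>] by simp
qed

lemma lift_m: "lift C k m \<in> Hom C I K" "k \<cdot> lift C k m = m"
proof -
  obtain j where "j \<in> Hom C I K" "k \<cdot> j = m"
    using is_kernel_factor[OF k_kernel d k m dm] .
  with lift_eqI[OF k_mono k] show "lift C k m \<in> Hom C I K" "k \<cdot> lift C k m = m" by simp_all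
qed

lemma lift_d': "lift C k d' \<in> Hom C A' K" "lift C k d' = lift C k m \<cdot> e" "k \<cdot> lift C k d' = d'"
proof -
  have "k \<cdot> (lift C k m \<cdot> e) = d'"
    using Comp_assoc[OF e lift_m(1) k] lift_m(2) me by simp
  with lift_eqI[OF k_mono k] Comp_in_Hom[OF e lift_m(1)]
  show "lift C k d' \<in> Hom C A' K" "lift C k d' = lift C k m \<cdot> e" "k \<cdot> lift C k d' = d'" by simp_all
qed

abbreviation q where "q \<equiv> cok C d'"

text \<open>Existence comes from \<open>m\<close>, which has a cokernel because it is normal;
  \<open>d'\<close> differs from \<open>m\<close> only by the epimorphism \<open>e\<close> and so
  has the same cokernels.\<close>

lemma q_cokernel: "is_cokernel C d' q" "is_cokernel C m q"
proof -
  have iff: "is_cokernel C d' c \<longleftrightarrow> is_cokernel C m c" for c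
    using is_cokernel_comp_epi_iff[OF e_regular e m] me by simp
  then show "is_cokernel C d' q"
    using normal_mono_cokernel_exists[OF normal] is_cokernel_cok by blast
  with iff show "is_cokernel C m q" by simp
qed

lemma q: "q \<in> Hom C A (Cok C d')" "is_regular_epi C q" "q \<cdot> m = zero_arr C I (Cok C d')"
  using is_cokernel_Hom[OF q_cokernel(2) m] is_regular_epi_if_cokernel[OF q_cokernel(1)]
    is_cokernel_comp[OF q_cokernel(2) m] unfolding Cok_def by simp_all

lemma q_kernel: "is_kernel C q m"
  using normal q_cokernel(2) by (rule normal_mono_is_kernel_of_cokernel)

lemma colift_d: "colift C q d \<in> Hom C (Cok C d') B" "colift C q d \<cdot> q = d"
proof -
  obtain u where "u \<in> Hom C (Cok C d') B" "u \<cdot> q = d"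
    using is_cokernel_factor[OF q_cokernel(1) d' q(1) d dd'] .
  with colift_eqI[OF q(2,1)] show "colift C q d \<in> Hom C (Cok C d') B" "colift C q d \<cdot> q = d"
    by simp_all
qed

abbreviation k' where "k' \<equiv> ker C (colift C q d)"
abbreviation K' where "K' \<equiv> Ker C (colift C q d)"

lemma k'_kernel: "is_kernel C (colift C q d) k'"
  using colift_d(1) by (rule is_kernel_ker_Hom)

lemma k': "k' \<in> Hom C K' (Cok C d')" "is_mono C k'" "colift C q d \<cdot> k' = zero_arr C K' B"
  using is_kernel_Hom[OF k'_kernel colift_d(1)] is_kernel_mono[OF k'_kernel]
    is_kernel_comp[OF k'_kernel colift_d(1)] unfolding Ker_def by auto

text \<open>A single \<open>p\<close> has to be a cokernel of both arrows: the one induced by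
  \<open>d'\<close> defines homology, the one induced by \<open>m\<close> is the degree
  \<open>n\<close> part of the inclusion of subcomplexes.\<close>

lemma lift_cokernel_exists:
  obtains p where "p \<in> Hom C K K'" "is_cokernel C (lift C k m) p" "is_cokernel C (lift C k d') p"
proof -
  let ?d = "colift C q d" and ?j = "lift C k m" and ?Q = "Cok C d'"
  have B: "B \<in> Obj C" using Hom_Obj[OF d] by simp
  have "?d \<cdot> (q \<cdot> k) = zero_arr C K B"
    using Comp_assoc[OF k q(1) colift_d(1)] colift_d(2) dk by simp
  then obtain p where p: "p \<in> Hom C K K'" "k' \<cdot> p = q \<cdot> k"
    using is_kernel_factor[OF k'_kernel colift_d(1) k'(1) Comp_in_Hom[OF k q(1)]] by metis
  \<comment> \<open>The reason is that \<open>d\<close> is \<open>q\<close> followed by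
    \<open>colift C q d\<close>: if \<open>q \<cdot> x\<close> factors through the kernel
    \<open>k'\<close>, then \<open>d\<close> kills \<open>x\<close>, and \<open>x\<close> factors
    through \<open>k\<close>.\<close>
  have "is_pullback C q k' k p"
    unfolding is_pullback_iff[OF q(1) k'(1) k p(1)]
  proof (intro conjI allI ballI impI)
    fix T x y assume x: "x \<in> Hom C T A" and y: "y \<in> Hom C T K'" and xy: "q \<cdot> x = k' \<cdot> y"
    have "d \<cdot> x = zero_arr C T B"
      using Comp_assoc[OF x q(1) colift_d(1)] colift_d(2) xy Comp_assoc[OF y k'(1) colift_d(1)] k'(3)
        zero_arr_comp[OF y B] by simp
    then obtain u where u: "u \<in> Hom C T K" "k \<cdot> u = x"
      using is_kernel_factor[OF k_kernel d k x] by metis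
    have "k' \<cdot> (p \<cdot> u) = k' \<cdot> y"
      using Comp_assoc[OF u(1) p(1) k'(1)] Comp_assoc[OF u(1) k q(1)] p(2) u(2) xy by simp
    then have "p \<cdot> u = y"
      by (rule is_monoD[OF k'(2,1) Comp_in_Hom[OF u(1) p(1)] y])
    with u show "\<exists>!u. u \<in> Hom C T K \<and> k \<cdot> u = x \<and> p \<cdot> u = y"
      using is_monoD[OF k_mono k] by metis
  qed (use p(2) in simp)
  then have p_reg: "is_regular_epi C p"
    by (rule regular_epis_stable[OF q(2)])
  have "k' \<cdot> (p \<cdot> ?j) = zero_arr C I ?Q"
    using Comp_assoc[OF lift_m(1) p(1) k'(1)] Comp_assoc[OF lift_m(1) k q(1)] p(2) lift_m(2) q(3) by simp
  then have pj: "p \<cdot> ?j = zero_arr C I K'"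
    by (rule mono_zero_cancel[OF k'(2,1) Comp_in_Hom[OF lift_m(1) p(1)]])
  \<comment> \<open>What \<open>p\<close> kills is killed by \<open>q\<close> after inclusion into
    \<open>A\<close>, hence factors through \<open>m\<close>, the kernel of \<open>q\<close>;
    monicity of \<open>k\<close> brings this back to \<open>K\<close>.\<close>
  have "is_kernel C p ?j"
  proof (rule is_kernelI[OF p(1) lift_m(1) pj])
    show "is_mono C ?j" using mono_factor[OF _ lift_m(1) k] lift_m(2) m_mono by simp
  next
    fix T x assume x: "x \<in> Hom C T K" "p \<cdot> x = zero_arr C T K'"
    have "q \<cdot> (k \<cdot> x) = zero_arr C T ?Q"
      using Comp_assoc[OF x(1) k q(1)] Comp_assoc[OF x(1) p(1) k'(1)] p(2) x(2)
        comp_zero_arr[OF k'(1) Hom_Obj(1)[OF x(1)]] by simp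
    then obtain u where u: "u \<in> Hom C T I" "m \<cdot> u = k \<cdot> x"
      using is_kernel_factor[OF q_kernel q(1) m Comp_in_Hom[OF x(1) k]] by metis
    have "k \<cdot> (?j \<cdot> u) = k \<cdot> x"
      using Comp_assoc[OF u(1) lift_m(1) k] lift_m(2) u(2) by simp
    then have "?j \<cdot> u = x"
      by (rule is_monoD[OF k_mono k Comp_in_Hom[OF u(1) lift_m(1)] x(1)])
    with u(1) show "\<exists>u. u \<in> Hom C T I \<and> ?j \<cdot> u = x" by blast
  qed
  then have "is_cokernel C ?j p"
    by (rule regular_epi_is_cokernel_of_kernel[OF p_reg p(1)])
  moreover have "is_cokernel C (lift C k d') p"
    using calculation is_cokernel_comp_epi_iff[OF e_regular e lift_m(1)] lift_d'(2) by simp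
  ultimately show ?thesis using that p(1) by blast
qed

lemma Cok_lift_isomorphic_Ker_colift:
  "isomorphic C (Cok C (lift C k d')) K'"
proof -
  obtain p where "p \<in> Hom C K K'" "is_cokernel C (lift C k d') p"
    using lift_cokernel_exists .
  with Cok_isomorphic show ?thesis by (metis Hom_Arr(3))
qed

end


section \<open>The category of chain complexes\<close>

context pointed_category
begin

lemma is_chain_iff:
  "is_chain C M \<longleftrightarrow> (\<forall>i. ob M i \<in> Obj C \<and> diff M i \<in> Hom C (ob M i) (ob M (i - 1)) \<and>
     diff M i \<cdot> diff M (i + 1) = zero_arr C (ob M (i + 1)) (ob M (i - 1)))"
proof -
  have "is_zero_arr C (diff M i \<cdot> diff M (i + 1)) \<longleftrightarrow>
      diff M i \<cdot> diff M (i + 1) = zero_arr C (ob M (i + 1)) (ob M (i - 1))"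
    if *: "\<And>i. diff M i \<in> Hom C (ob M i) (ob M (i - 1))" for i
    by (rule is_zero_arr_iff[OF Comp_in_Hom[OF *[of "i + 1", simplified] *[of i]]])
  then show ?thesis unfolding is_chain_def by blast
qed

lemma is_chainD:
  assumes "is_chain C M"
  shows "ob M i \<in> Obj C" "diff M i \<in> Hom C (ob M i) (ob M (i - 1))"
    "diff M i \<cdot> diff M (i + 1) = zero_arr C (ob M (i + 1)) (ob M (i - 1))"
  using assms unfolding is_chain_iff by blast+

lemma Hom_Ch_iff:
  "(M', N', f) \<in> Hom (Ch C) M N \<longleftrightarrow> M' = M \<and> N' = N \<and> is_chain C M \<and> is_chain C N \<and>
     (\<forall>i. f i \<in> Hom C (ob M i) (ob N i) \<and> diff N i \<cdot> f i = f (i - 1) \<cdot> diff M i)"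
  unfolding Hom_def[of "Ch C"] by (auto simp: Ch_def)

lemma Hom_ChE:
  assumes "x \<in> Hom (Ch C) M N"
  obtains f where "x = (M, N, f)" "is_chain C M" "is_chain C N"
    "\<And>i. f i \<in> Hom C (ob M i) (ob N i)" "\<And>i. diff N i \<cdot> f i = f (i - 1) \<cdot> diff M i"
  using assms by (cases x) (auto simp: Hom_Ch_iff)

lemma Comp_Ch: "(N, P, g) \<cdot>\<^bsub>Ch C\<^esub> (M, N', f) = (M, P, \<lambda>i. g i \<cdot> f i)"
  by (simp add: Ch_def)

lemma Ident_Ch: "Ident (Ch C) M = (M, M, \<lambda>i. Ident C (ob M i))"
  by (simp add: Ch_def)

lemma Obj_Ch: "M \<in> Obj (Ch C) \<longleftrightarrow> is_chain C M"
  by (simp add: Ch_def)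

lemma Ident_zero_obj: "Ident C (zero_obj C) = zero_arr C (zero_obj C) (zero_obj C)"
  by (intro to_zero_obj Ident_in_Hom zero_obj_in_Obj)

section \<open>Concentrated complexes and zero arrows in \<open>Ch C\<close>\<close>

lemma ob_concentrated: "ob (concentrated C n A) i = (if i = n then A else zero_obj C)"
  by (simp add: concentrated_def Let_def)

lemma diff_concentrated:
  "diff (concentrated C n A) i = zero_arr C (ob (concentrated C n A) i) (ob (concentrated C n A) (i - 1))"
  by (simp add: concentrated_def Let_def)

lemma is_chain_concentrated:
  assumes "A \<in> Obj C"
  shows "is_chain C (concentrated C n A)"
proof -
  have ob: "ob (concentrated C n A) i \<in> Obj C" for i
    using assms by (simp add: ob_concentrated)
  show ?thesis
    unfolding is_chain_iff diff_concentrated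
    using ob zero_arr_in_Hom[OF ob ob] zero_arr_comp[OF zero_arr_in_Hom[OF ob ob] ob] by simp
qed

lemma zero_Hom_Ch:
  assumes "is_chain C M" "is_chain C N"
  shows "(M, N, \<lambda>i. zero_arr C (ob M i) (ob N i)) \<in> Hom (Ch C) M N"
  unfolding Hom_Ch_iff
  using assms zero_arr_in_Hom is_chainD(1) comp_zero_arr[OF is_chainD(2)[OF assms(2)]]
    zero_arr_comp[OF is_chainD(2)[OF assms(1)]] by auto

lemma is_zero_obj_Ch: "is_zero_obj (Ch C) (concentrated C n (zero_obj C))"
proof -
  let ?Z = "concentrated C n (zero_obj C)"
  have Z: "is_chain C ?Z" by (simp add: is_chain_concentrated)
  have ob: "ob ?Z i = zero_obj C" for i by (simp add: ob_concentrated)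
  have "f = (?Z, N, \<lambda>i. zero_arr C (ob ?Z i) (ob N i))" if "f \<in> Hom (Ch C) ?Z N" for f N
    using that by (rule Hom_ChE) (auto simp: ob intro: from_zero_obj)
  moreover have "f = (N, ?Z, \<lambda>i. zero_arr C (ob N i) (ob ?Z i))" if "f \<in> Hom (Ch C) N ?Z" for f N
    using that by (rule Hom_ChE) (auto simp: ob intro: to_zero_obj)
  ultimately show ?thesis
    unfolding is_zero_obj_def is_initial_def is_terminal_def Obj_Ch Ball_def
    using Z zero_Hom_Ch[OF Z] zero_Hom_Ch[OF _ Z] by blast
qed

lemma pointed_category_Ch: "pointed_category (Ch C)"
proof -
  interpret Ch: category "Ch C" by (intro category_Ch category_axioms)
  show ?thesis by unfold_locales (use is_zero_obj_Ch in blast)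
qed

text \<open>Zero arrows are defined by factoring through a zero object; the degreewise zero map
  factors through the zero complex, and uniqueness does the rest.\<close>

lemma zero_arr_Ch:
  assumes "is_chain C M" "is_chain C N"
  shows "zero_arr (Ch C) M N = (M, N, \<lambda>i. zero_arr C (ob M i) (ob N i))"
proof -
  interpret Ch: pointed_category "Ch C" by (rule pointed_category_Ch)
  let ?Z = "concentrated C 0 (zero_obj C)"
  have Z: "is_chain C ?Z" by (simp add: is_chain_concentrated)
  let ?f = "(M, N, \<lambda>i. zero_arr C (ob M i) (ob N i))"
  have "?f = (?Z, N, \<lambda>i. zero_arr C (ob ?Z i) (ob N i)) \<cdot>\<^bsub>Ch C\<^esub> (M, ?Z, \<lambda>i. zero_arr C (ob M i) (ob ?Z i))"
    using zero_arr_comp[OF zero_arr_in_Hom] is_chainD(1) assms Z by (simp add: Comp_Ch)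
  then have "is_zero_arr (Ch C) ?f"
    unfolding is_zero_arr_def Ch.Hom_Arr(2,3)[OF zero_Hom_Ch[OF assms]]
    using Ch.Hom_Arr(1)[OF zero_Hom_Ch[OF assms]] is_zero_obj_Ch zero_Hom_Ch Z assms by blast
  then show ?thesis
    using Ch.is_zero_arr_iff[OF zero_Hom_Ch[OF assms]] by simp
qed

lemma Hom_concentratedI:
  assumes "f \<in> Hom C A B"
  shows "(concentrated C n A, concentrated C n B, \<lambda>i. if i = n then f else zero_arr C (zero_obj C) (zero_obj C))
    \<in> Hom (Ch C) (concentrated C n A) (concentrated C n B)"
    (is "(?A, ?B, ?f) \<in> _")
proof -
  note AB = Hom_Obj[OF assms]
  have f: "?f i \<in> Hom C (ob ?A i) (ob ?B i)" for i
    using assms zero_arr_in_Hom by (simp add: ob_concentrated)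
  have ob: "ob ?A i \<in> Obj C" "ob ?B i \<in> Obj C" for i
    using AB by (simp_all add: ob_concentrated)
  have "diff ?B i \<cdot> ?f i = ?f (i - 1) \<cdot> diff ?A i" for i
    unfolding diff_concentrated zero_arr_comp[OF f ob(2)] comp_zero_arr[OF f ob(1)] ..
  then show ?thesis
    using f AB is_chain_concentrated unfolding Hom_Ch_iff by blast
qed

lemma isomorphic_concentrated:
  assumes "isomorphic C A B"
  shows "isomorphic (Ch C) (concentrated C n A) (concentrated C n B)"
proof -
  interpret Ch: category "Ch C" by (intro category_Ch category_axioms)
  obtain f g where fg: "f \<in> Hom C A B" "g \<in> Hom C B A" "g \<cdot> f = Ident C A" "f \<cdot> g = Ident C B"
    using assms by (rule isomorphicE)
  \<comment> \<open>Off degree \<open>n\<close> both composites are this zero endomorphism, which is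
    the identity of the zero object.\<close>
  have z: "zero_arr C (zero_obj C) (zero_obj C) \<cdot> zero_arr C (zero_obj C) (zero_obj C) =
      Ident C (zero_obj C)"
    using zero_arr_comp[OF zero_arr_in_Hom] by (simp add: Ident_zero_obj)
  show ?thesis
    by (rule Ch.isomorphicI[OF Hom_concentratedI[OF fg(1)] Hom_concentratedI[OF fg(2)]])
      (auto simp: Comp_Ch Ident_Ch ob_concentrated fg(3,4) z)
qed

end


section \<open>The quotient of the torsion subcomplexes\<close>

locale proper_complex = semi_abelian_category +
  fixes M and n :: int
  assumes proper: "is_proper_chain C M"
begin

lemma M_chain: "is_chain C M"
  using proper by (simp add: is_proper_chain_def)

lemmas M = is_chainD[OF M_chain]

end

text \<open>Dictionary: \<open>pair.K\<close> is the kernel of \<open>diff M n\<close>,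
  \<open>pair.I\<close> the image and \<open>pair.q\<close> the cokernel of
  \<open>diff M (n + 1)\<close>, and \<open>pair.K'\<close> is
  \<open>dual_homology C M n\<close>.\<close>

sublocale proper_complex \<subseteq> pair: proper_pair C "ob M (n + 1)" "ob M n" "ob M (n - 1)"
  "diff M (n + 1)" "diff M n" "img_epi C (diff M (n + 1))" "img_mono C (diff M (n + 1))"
proof
  show d': "diff M (n + 1) \<in> Hom C (ob M (n + 1)) (ob M n)"
    using M(2)[of "n + 1"] by simp
  show "is_factorization C (diff M (n + 1)) (img_epi C (diff M (n + 1))) (img_mono C (diff M (n + 1)))"
    using d' by (rule is_factorization_img)
  then show "is_normal_mono C (img_mono C (diff M (n + 1)))"
    using proper unfolding is_proper_chain_def by blast
qed (use M in blast)+

context proper_complex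
begin

abbreviation P where "P \<equiv> ker_part C n M"
abbreviation Q where "Q \<equiv> cok_part C (n + 1) M"
abbreviation Z where "Z \<equiv> zero_obj C"

lemma ob_P: "ob P i = (if i > n then ob M i else if i = n then pair.K else Z)"
  by (simp add: ker_part_def Let_def)

lemma diff_P: "diff P i = (if i > n + 1 then diff M i
    else if i = n + 1 then lift C pair.k (diff M (n + 1)) else zero_arr C (ob P i) (ob P (i - 1)))"
  by (simp add: ker_part_def Let_def)

text \<open>At index \<open>n + 1\<close> the image sits in degree \<open>n\<close>; the case
  distinction is brought into the form used for \<open>P\<close>, so that one truncation argument
  fits both.\<close>

lemma ob_Q: "ob Q i = (if i > n then ob M i else if i = n then pair.I else Z)"
  by (simp add: cok_part_def Let_def Img_def)

lemma diff_Q: "diff Q i = (if i > n + 1 then diff M i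
    else if i = n + 1 then img_epi C (diff M (n + 1)) else zero_arr C (ob Q i) (ob Q (i - 1)))"
  by (auto simp: cok_part_def Let_def Img_def)

text \<open>Truncating \<open>M\<close> at a monomorphism \<open>j\<close> into \<open>M\<^sub>n\<close> through which \<open>\<delta>\<^bsub>n+1\<^esub>\<close> factors
  covers \<open>ker_part\<close> as well as \<open>cok_part\<close>.\<close>

lemma truncation:
  assumes ob: "\<And>i. ob N i = (if i > n then ob M i else if i = n then J else Z)"
    and diff: "\<And>i. diff N i = (if i > n + 1 then diff M i else if i = n + 1 then l
      else zero_arr C (ob N i) (ob N (i - 1)))"
    and j: "j \<in> Hom C J (ob M n)" "is_mono C j" "diff M n \<cdot> j = zero_arr C J (ob M (n - 1))"
    and l: "l \<in> Hom C (ob M (n + 1)) J" "j \<cdot> l = diff M (n + 1)"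
  shows is_chain_truncation: "is_chain C N"
    and truncation_incl: "(N, M, \<lambda>i. if i > n then Ident C (ob M i) else if i = n then j
      else zero_arr C Z (ob M i)) \<in> Hom (Ch C) N M" (is "(_, _, ?\<iota>) \<in> _")
proof -
  have obN: "ob N i \<in> Obj C" for i
    using M(1) Hom_Obj(1)[OF j(1)] by (simp add: ob)
  have diffN: "diff N i \<in> Hom C (ob N i) (ob N (i - 1))" for i
  proof -
    consider "i > n + 1" | "i = n + 1" | "i \<le> n" by linarith
    then show ?thesis
    proof cases
      case 1 then show ?thesis using M(2)[of i] by (simp add: diff ob)
    next
      case 2 then show ?thesis using l(1) by (simp add: diff ob)
    next
      case 3 then show ?thesis using zero_arr_in_Hom[OF obN obN] by (simp add: diff)
    qed
  qed
  have "diff N i \<cdot> diff N (i + 1) = zero_arr C (ob N (i + 1)) (ob N (i - 1))" for i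
  proof -
    consider "i > n + 1" | "i = n + 1" | "i \<le> n" by linarith
    then show ?thesis
    proof cases
      case 1 then show ?thesis using M(3)[of i] by (simp add: diff ob)
    next
      case 2
      have d: "diff M (i + 1) \<in> Hom C (ob M (i + 1)) (ob M (n + 1))"
        using M(2)[of "i + 1"] by (simp only: 2 add_diff_cancel_right')
      \<comment> \<open>This composite ends in \<open>J\<close>. It is tested after the monomorphism
        \<open>j\<close>, where it becomes a composite of two differentials of
        \<open>M\<close>.\<close>
      have "j \<cdot> (l \<cdot> diff M (i + 1)) = zero_arr C (ob M (i + 1)) (ob M n)"
        using Comp_assoc[OF d l(1) j(1)] l(2) M(3)[of i] 2 by simp
      then have "l \<cdot> diff M (i + 1) = zero_arr C (ob M (i + 1)) J"
        by (rule mono_zero_cancel[OF j(2,1) Comp_in_Hom[OF d l(1)]])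
      then show ?thesis using 2 by (simp add: diff ob)
    next
      case 3
      have "diff N (i + 1) \<in> Hom C (ob N (i + 1)) (ob N i)" using diffN[of "i + 1"] by simp
      moreover have "diff N i = zero_arr C (ob N i) (ob N (i - 1))" using 3 by (simp add: diff)
      ultimately show ?thesis using zero_arr_comp obN by simp
    qed
  qed
  with obN diffN show chain: "is_chain C N" unfolding is_chain_iff by blast
  have \<iota>: "?\<iota> i \<in> Hom C (ob N i) (ob M i)" for i
    using Ident_in_Hom[OF M(1)] j(1) zero_arr_in_Hom[OF zero_obj_in_Obj M(1)] by (simp add: ob)
  have "diff M i \<cdot> ?\<iota> i = ?\<iota> (i - 1) \<cdot> diff N i" for i
  proof -
    consider "i > n + 1" | "i = n + 1" | "i = n" | "i < n" by linarith
    then show ?thesis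
    proof cases
      case 1
      then show ?thesis using Comp_Ident[OF M(2)] Ident_Comp[OF M(2)] by (simp add: diff)
    next
      case 2
      then show ?thesis using Comp_Ident[OF M(2)] l(2) by (simp add: diff)
    next
      \<comment> \<open>The component in degree \<open>n - 1\<close> starts at the zero object, so
        the square commutes precisely because \<open>diff M n\<close> kills
        \<open>j\<close>.\<close>
      case 3
      then show ?thesis
        using j(3) zero_arr_comp[OF zero_arr_in_Hom[OF Hom_Obj(1)[OF j(1)] zero_obj_in_Obj] M(1)]
        by (simp add: diff ob)
    next
      case 4
      then show ?thesis
        using comp_zero_arr[OF M(2) zero_obj_in_Obj]
          zero_arr_comp[OF zero_arr_in_Hom[OF zero_obj_in_Obj zero_obj_in_Obj] M(1)]
        by (simp add: diff ob)
    qed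
  qed
  with \<iota> chain M_chain show "(N, M, ?\<iota>) \<in> Hom (Ch C) N M" unfolding Hom_Ch_iff by blast
qed

lemma P_chain: "is_chain C P"
  and ker_incl_Hom: "ker_incl C n M \<in> Hom (Ch C) P M"
proof -
  note * = ob_P diff_P pair.k pair.k_mono pair.dk pair.lift_d'(1,3)
  show "is_chain C P" by (rule is_chain_truncation[OF *])
  show "ker_incl C n M \<in> Hom (Ch C) P M" unfolding ker_incl_def by (rule truncation_incl[OF *])
qed

lemma Q_chain: "is_chain C Q"
  and cok_incl_eq: "cok_incl C (n + 1) M = (Q, M, \<lambda>i. if i > n then Ident C (ob M i)
    else if i = n then img_mono C (diff M (n + 1)) else zero_arr C Z (ob M i))"
proof -
  note * = ob_Q diff_Q pair.m pair.m_mono pair.dm pair.e pair.me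
  show "is_chain C Q" by (rule is_chain_truncation[OF *])
  show "cok_incl C (n + 1) M = (Q, M, \<lambda>i. if i > n then Ident C (ob M i)
    else if i = n then img_mono C (diff M (n + 1)) else zero_arr C Z (ob M i))"
    by (auto simp: cok_incl_def)
qed

text \<open>Cancellation is degreewise: identities above \<open>n\<close>, a kernel in degree
  \<open>n\<close>, and below \<open>n\<close> any two arrows into the zero object agree. It is
  needed to evaluate \<open>lift\<close> in \<open>Ch C\<close>.\<close>

lemma is_mono_ker_incl: "is_mono (Ch C) (ker_incl C n M)"
proof -
  interpret Ch: pointed_category "Ch C" by (rule pointed_category_Ch)
  show ?thesis
  proof (rule Ch.is_monoI[OF ker_incl_Hom])
    fix T x y assume x: "x \<in> Hom (Ch C) T P" and y: "y \<in> Hom (Ch C) T P"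
      and eq: "ker_incl C n M \<cdot>\<^bsub>Ch C\<^esub> x = ker_incl C n M \<cdot>\<^bsub>Ch C\<^esub> y"
    obtain f where f: "x = (T, P, f)" "\<And>i. f i \<in> Hom C (ob T i) (ob P i)" using x by (rule Hom_ChE) blast
    obtain g where g: "y = (T, P, g)" "\<And>i. g i \<in> Hom C (ob T i) (ob P i)" using y by (rule Hom_ChE) blast
    let ?\<iota> = "\<lambda>i. if i > n then Ident C (ob M i) else if i = n then pair.k else zero_arr C Z (ob M i)"
    have *: "?\<iota> i \<cdot> f i = ?\<iota> i \<cdot> g i" for i
      using eq unfolding f(1) g(1) ker_incl_def Comp_Ch by (auto dest: fun_cong[where x = i])
    have "f i = g i" for i
    proof -
      consider "i > n" | "i = n" | "i < n" by linarith
      then show ?thesis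
      proof cases
        case 1
        then have "f i \<in> Hom C (ob T i) (ob M i)" "g i \<in> Hom C (ob T i) (ob M i)"
          using f(2)[of i] g(2)[of i] by (simp_all add: ob_P)
        then show ?thesis using *[of i] 1 Ident_Comp by simp
      next
        case 2
        then have "f i \<in> Hom C (ob T i) pair.K" "g i \<in> Hom C (ob T i) pair.K"
          using f(2)[of i] g(2)[of i] by (simp_all add: ob_P)
        then show ?thesis using is_monoD[OF pair.k_mono pair.k] *[of i] 2 by simp
      next
        case 3
        then have "f i \<in> Hom C (ob T i) Z" "g i \<in> Hom C (ob T i) Z"
          using f(2)[of i] g(2)[of i] by (simp_all add: ob_P)
        then show ?thesis using to_zero_obj by metis
      qed
    qed
    then show "x = y" using f(1) g(1) by auto
  qed
qed

abbreviation incl where "incl \<equiv> (Q, P, \<lambda>i. if i > n then Ident C (ob M i)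
  else if i = n then lift C pair.k (img_mono C (diff M (n + 1))) else zero_arr C Z Z)"

lemma incl_Hom: "incl \<in> Hom (Ch C) Q P"
proof -
  let ?u = "\<lambda>i. if i > n then Ident C (ob M i)
    else if i = n then lift C pair.k (img_mono C (diff M (n + 1))) else zero_arr C Z Z"
  have u: "?u i \<in> Hom C (ob Q i) (ob P i)" for i
    using Ident_in_Hom[OF M(1)] pair.lift_m(1) zero_arr_in_Hom[OF zero_obj_in_Obj zero_obj_in_Obj]
    by (simp add: ob_P ob_Q)
  have "diff P i \<cdot> ?u i = ?u (i - 1) \<cdot> diff Q i" for i
  proof -
    consider "i > n + 1" | "i = n + 1" | "i \<le> n" by linarith
    then show ?thesis
    proof cases
      case 1
      then show ?thesis using Comp_Ident[OF M(2)] Ident_Comp[OF M(2)] by (simp add: diff_P diff_Q)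
    next
      case 2
      then show ?thesis
        using Comp_Ident[OF pair.lift_d'(1)] pair.lift_d'(2) by (simp add: diff_P diff_Q)
    next
      case 3
      then have "diff P i = zero_arr C (ob P i) (ob P (i - 1))"
        "diff Q i = zero_arr C (ob Q i) (ob Q (i - 1))"
        by (simp_all add: diff_P diff_Q)
      then show ?thesis
        using zero_arr_comp[OF u[of i] is_chainD(1)[OF P_chain]]
          comp_zero_arr[OF u[of "i - 1"] is_chainD(1)[OF Q_chain]] by simp
    qed
  qed
  with u P_chain Q_chain show ?thesis unfolding Hom_Ch_iff by blast
qed

text \<open>This is the factorization witnessing that the one subobject lies in the other, so
  \<open>subobj_quotient\<close> becomes the cokernel of an explicit chain map.\<close>

lemma lift_ker_incl_cok_incl: "lift (Ch C) (ker_incl C n M) (cok_incl C (n + 1) M) = incl"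
proof -
  interpret Ch: pointed_category "Ch C" by (rule pointed_category_Ch)
  have "ker_incl C n M \<cdot>\<^bsub>Ch C\<^esub> incl = cok_incl C (n + 1) M"
    unfolding cok_incl_eq ker_incl_def Comp_Ch
    using Ident_Comp[OF Ident_in_Hom[OF M(1)]] pair.lift_m(2)
      zero_arr_comp[OF zero_arr_in_Hom[OF zero_obj_in_Obj zero_obj_in_Obj] M(1)] by auto
  then show ?thesis
    by (rule Ch.lift_eqI[OF is_mono_ker_incl ker_incl_Hom incl_Hom])
qed

text \<open>A chain map that kills \<open>incl\<close> vanishes above degree \<open>n\<close>, where
  \<open>incl\<close> is an identity, and below it, where its source is zero. Only its component in
  degree \<open>n\<close> remains, and that factors uniquely through \<open>p\<close>.\<close>

lemma is_cokernel_incl: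
  assumes p: "p \<in> Hom C pair.K D"
    and cok: "is_cokernel C (lift C pair.k (img_mono C (diff M (n + 1)))) p"
      "is_cokernel C (lift C pair.k (diff M (n + 1))) p"
  shows "is_cokernel (Ch C) incl
    (P, concentrated C n D, \<lambda>i. if i = n then p else zero_arr C (ob P i) Z)"
    (is "is_cokernel _ _ (P, ?D, ?\<pi>)")
proof -
  interpret Ch: pointed_category "Ch C" by (rule pointed_category_Ch)
  let ?j = "lift C pair.k (img_mono C (diff M (n + 1)))" and ?l = "lift C pair.k (diff M (n + 1))"
  have D: "D \<in> Obj C" using Hom_Obj[OF p] by simp
  note D_chain = is_chain_concentrated[OF D, of n]
  note obP = is_chainD(1)[OF P_chain] and obD = is_chainD(1)[OF D_chain]
  have p_cancel: "x = y" if "x \<in> Hom C D T" "y \<in> Hom C D T" "x \<cdot> p = y \<cdot> p" for x y T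
    using cokernel_cancel[OF cok(1) p] that .
  have \<pi>: "?\<pi> i \<in> Hom C (ob P i) (ob ?D i)" for i
    using p zero_arr_in_Hom[OF obP zero_obj_in_Obj] by (simp add: ob_P ob_concentrated)
  have "diff ?D i \<cdot> ?\<pi> i = ?\<pi> (i - 1) \<cdot> diff P i" for i
  proof -
    have "?\<pi> (i - 1) \<cdot> diff P i = zero_arr C (ob P i) (ob ?D (i - 1))"
    \<comment> \<open>Only for \<open>i - 1 = n\<close> is the component of the projection not a
      zero arrow by definition; there \<open>p\<close> kills the differential of
      \<open>P\<close>.\<close>
    proof (cases "i = n + 1")
      case True
      then show ?thesis
        using is_cokernel_comp[OF cok(2) pair.lift_d'(1) p]
        by (simp add: diff_P ob_P ob_concentrated)
    next
      case False
      then show ?thesis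
        using zero_arr_comp[OF is_chainD(2)[OF P_chain] zero_obj_in_Obj]
        by (simp add: ob_concentrated)
    qed
    then show ?thesis
      unfolding diff_concentrated using zero_arr_comp[OF \<pi>[of i] obD] by simp
  qed
  with \<pi> P_chain D_chain have \<pi>H: "(P, ?D, ?\<pi>) \<in> Hom (Ch C) P ?D" unfolding Hom_Ch_iff by blast
  show ?thesis
  proof (rule Ch.is_cokernelI[OF incl_Hom \<pi>H])
    have "?\<pi> i \<cdot> Ident C (ob M i) = zero_arr C (ob Q i) (ob ?D i)" if "i > n" for i
      using that Comp_Ident[OF zero_arr_in_Hom[OF M(1) zero_obj_in_Obj]]
      by (simp add: ob_Q ob_P ob_concentrated)
    moreover have "p \<cdot> ?j = zero_arr C (ob Q n) (ob ?D n)"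
      using is_cokernel_comp[OF cok(1) pair.lift_m(1) p] by (simp add: ob_Q ob_concentrated)
    moreover have "?\<pi> i \<cdot> zero_arr C Z Z = zero_arr C (ob Q i) (ob ?D i)" if "i < n" for i
      using that comp_zero_arr[OF zero_arr_in_Hom[OF zero_obj_in_Obj zero_obj_in_Obj] zero_obj_in_Obj]
      by (simp add: ob_Q ob_P ob_concentrated)
    ultimately show "(P, ?D, ?\<pi>) \<cdot>\<^bsub>Ch C\<^esub> incl = zero_arr (Ch C) Q ?D"
      unfolding Comp_Ch zero_arr_Ch[OF Q_chain D_chain] by (auto simp: fun_eq_iff)
  next
    fix T x assume x: "x \<in> Hom (Ch C) P T" and xz: "x \<cdot>\<^bsub>Ch C\<^esub> incl = zero_arr (Ch C) Q T"
    obtain f where f: "x = (P, T, f)" "is_chain C T" "\<And>i. f i \<in> Hom C (ob P i) (ob T i)"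
      "\<And>i. diff T i \<cdot> f i = f (i - 1) \<cdot> diff P i"
      using x by (rule Hom_ChE) blast
    note T = is_chainD[OF f(2)]
    have fz: "f i \<cdot> (if i > n then Ident C (ob M i) else if i = n then ?j else zero_arr C Z Z) =
        zero_arr C (ob Q i) (ob T i)" for i
      using xz unfolding f(1) Comp_Ch zero_arr_Ch[OF Q_chain f(2)] by (auto dest: fun_cong[where x = i])
    have fi: "f i = zero_arr C (ob P i) (ob T i)" if "i \<noteq> n" for i
    proof (cases "i > n")
      case True
      then have "f i \<in> Hom C (ob M i) (ob T i)" using f(3)[of i] by (simp add: ob_P)
      then show ?thesis using fz[of i] True Comp_Ident by (simp add: ob_P ob_Q)
    next
      case False
      then show ?thesis using that f(3)[of i] from_zero_obj by (simp add: ob_P)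
    qed
    have fn: "f n \<in> Hom C pair.K (ob T n)" using f(3)[of n] by (simp add: ob_P)
    have "f n \<cdot> ?j = zero_arr C pair.I (ob T n)" using fz[of n] by (simp add: ob_Q)
    then obtain y where y: "y \<in> Hom C D (ob T n)" "y \<cdot> p = f n"
      using is_cokernel_factor[OF cok(1) pair.lift_m(1) p fn] by metis
    \<comment> \<open>The concentrated complex has zero differentials, so \<open>y\<close> yields a
      chain map only if \<open>diff T n\<close> kills it. This is checked after cancelling
      \<open>p\<close>, where it follows from the vanishing of \<open>f (n - 1)\<close>.\<close>
    have dy: "diff T n \<cdot> y = zero_arr C D (ob T (n - 1))"
    proof (rule p_cancel[OF Comp_in_Hom[OF y(1) T(2)] zero_arr_in_Hom[OF D T(1)]])
      have "diff T n \<cdot> f n = zero_arr C pair.K (ob T (n - 1))"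
        using f(4)[of n] fi[of "n - 1"] zero_arr_comp[OF is_chainD(2)[OF P_chain, of n] T(1)]
        by (simp add: ob_P)
      then show "(diff T n \<cdot> y) \<cdot> p = zero_arr C D (ob T (n - 1)) \<cdot> p"
        using Comp_assoc[OF p y(1) T(2)] y(2) zero_arr_comp[OF p T(1)] by simp
    qed
    let ?y = "\<lambda>i. if i = n then y else zero_arr C Z (ob T i)"
    have yH: "?y i \<in> Hom C (ob ?D i) (ob T i)" for i
      using y(1) zero_arr_in_Hom[OF zero_obj_in_Obj T(1)] by (simp add: ob_concentrated)
    have "diff T i \<cdot> ?y i = ?y (i - 1) \<cdot> diff ?D i" for i
      unfolding diff_concentrated comp_zero_arr[OF yH obD]
      using dy comp_zero_arr[OF T(2) zero_obj_in_Obj] by (simp add: ob_concentrated)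
    with yH D_chain f(2) have "(?D, T, ?y) \<in> Hom (Ch C) ?D T" unfolding Hom_Ch_iff by blast
    moreover have "?y i \<cdot> ?\<pi> i = f i" for i
      using y(2) fi[of i] zero_arr_comp[OF zero_arr_in_Hom[OF obP zero_obj_in_Obj] T(1)] by simp
    then have "(?D, T, ?y) \<cdot>\<^bsub>Ch C\<^esub> (P, ?D, ?\<pi>) = x" unfolding Comp_Ch f(1) by auto
    ultimately show "\<exists>u. u \<in> Hom (Ch C) ?D T \<and> u \<cdot>\<^bsub>Ch C\<^esub> (P, ?D, ?\<pi>) = x" by blast
  next
    fix T x y assume x: "x \<in> Hom (Ch C) ?D T" and y: "y \<in> Hom (Ch C) ?D T"
      and eq: "x \<cdot>\<^bsub>Ch C\<^esub> (P, ?D, ?\<pi>) = y \<cdot>\<^bsub>Ch C\<^esub> (P, ?D, ?\<pi>)"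
    obtain f where f: "x = (?D, T, f)" "\<And>i. f i \<in> Hom C (ob ?D i) (ob T i)" using x by (rule Hom_ChE) blast
    obtain g where g: "y = (?D, T, g)" "\<And>i. g i \<in> Hom C (ob ?D i) (ob T i)" using y by (rule Hom_ChE) blast
    have "f n \<cdot> p = g n \<cdot> p"
      using eq unfolding f(1) g(1) Comp_Ch by (auto dest: fun_cong[where x = n])
    then have "f n = g n" using f(2)[of n] g(2)[of n] p_cancel by (simp add: ob_concentrated)
    moreover have "f i = g i" if "i \<noteq> n" for i
      using that f(2)[of i] g(2)[of i] from_zero_obj[of "f i" "ob T i"] from_zero_obj[of "g i" "ob T i"]
      by (simp add: ob_concentrated)
    ultimately have "f i = g i" for i by (cases "i = n") auto
    then show "x = y" using f(1) g(1) by auto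
  qed
qed

lemma homology_isomorphic_dual_homology: "isomorphic C (homology C M n) (dual_homology C M n)"
  unfolding homology_def dual_homology_def by (rule pair.Cok_lift_isomorphic_Ker_colift)

lemma dual_homology_isomorphic_quotient:
  "isomorphic (Ch C) (concentrated C n (dual_homology C M n))
    (subobj_quotient (Ch C) (ker_incl C n M) (cok_incl C (n + 1) M))"
proof -
  interpret Ch: pointed_category "Ch C" by (rule pointed_category_Ch)
  obtain p where "p \<in> Hom C pair.K pair.K'"
    "is_cokernel C (lift C pair.k (img_mono C (diff M (n + 1)))) p"
    "is_cokernel C (lift C pair.k (diff M (n + 1))) p"
    using pair.lift_cokernel_exists .
  from Ch.Cok_isomorphic[OF is_cokernel_incl[OF this]]
  have "isomorphic (Ch C) (Cok (Ch C) incl) (concentrated C n pair.K')"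
    by (simp add: Ch_def)
  then show ?thesis
    unfolding subobj_quotient_def lift_ker_incl_cok_incl dual_homology_def
    by (rule Ch.isomorphic_sym)
qed

end

theorem lemma4p1:
  fixes C :: "('o, 'm) cat" and M :: "('o, 'm) chain" and n :: int
  assumes "semi_abelian_category C"
    and "is_proper_chain C M"
  shows "isomorphic C (homology C M n) (dual_homology C M n)
       \<and> isomorphic (Ch C) (concentrated C n (homology C M n))
                          (concentrated C n (dual_homology C M n))
       \<and> isomorphic (Ch C) (concentrated C n (dual_homology C M n))
                          (subobj_quotient (Ch C) (ker_incl C n M) (cok_incl C (n + 1) M))"
proof -
  interpret semi_abelian_category C by fact
  interpret proper_complex C M n by unfold_locales fact
  show ?thesis
    using homology_isomorphic_dual_homology dual_homology_isomorphic_quotient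
      isomorphic_concentrated by blast
qed

end
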